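(* Let $n\ge2$ and $\sigma\ge0$. There is a reduced pointed degree-three sphere map (from $\mathbb B^n$ to some $\mathbb B^N$) with denominator \[ g(z)=1+\sigma\sum_{j=1}^nz_j^2 \] if and only if \[ \sigma<\sqrt{\frac{3}{n+2}} . \]
   Context: $\mathbb B^n$ is the open unit ball of $\mathbb C^n$. A (rational) sphere map with denominator $g$ is a rational map $F=P/g$, holomorphic on $\mathbb B^n$, with $P=(p_1,\dots,p_N)^t\colon\mathbb C^n\to\mathbb C^N$ a polynomial map and $\|P(z)\|^2=|g(z)|^2$ for all $z\in\partial\mathbb B^n$. It is reduced if $g,p_1,\dots,p_N$ have no common nonconstant polynomial factor; then $\deg F=\max\{\deg P,\deg g\}$. With $g(0)=1$, it is pointed if $P(0)=0$. *)

theory Defs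
  imports "HOL-Analysis.Analysis" "HOL-Library.Poly_Mapping"
begin

text \<open>
  Complex polynomials in variables indexed by a finite type: finitely supported maps
  from exponent vectors to coefficients, with the convolution ring structure of
  \<^typ>\<open>'a \<Rightarrow>\<^sub>0 'b\<close>.
\<close>

type_synonym 'n cpoly = "('n \<Rightarrow>\<^sub>0 nat) \<Rightarrow>\<^sub>0 complex"

definition Cst :: "complex \<Rightarrow> 'n cpoly"
  where "Cst c = Poly_Mapping.single 0 c"

definition Var :: "'n \<Rightarrow> 'n cpoly"
  where "Var j = Poly_Mapping.single (Poly_Mapping.single j 1) 1"

definition eval_cpoly :: "'n::finite cpoly \<Rightarrow> complex ^ 'n \<Rightarrow> complex"
  where "eval_cpoly p z =
    (\<Sum>m\<in>Poly_Mapping.keys p.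
       Poly_Mapping.lookup p m * (\<Prod>j\<in>UNIV. (z $ j) ^ Poly_Mapping.lookup m j))"

text \<open>Total degree; the zero polynomial has degree 0.\<close>

definition total_degree :: "'n::finite cpoly \<Rightarrow> nat"
  where "total_degree p =
    Max (insert 0 ((\<lambda>m. \<Sum>j\<in>UNIV. Poly_Mapping.lookup m j) ` Poly_Mapping.keys p))"

definition holomorphic_mv_on :: "(complex ^ 'n::finite \<Rightarrow> complex) \<Rightarrow> (complex ^ 'n) set \<Rightarrow> bool"
  where "holomorphic_mv_on f S \<longleftrightarrow>
    (\<forall>z\<in>S. \<exists>f'. (f has_derivative f') (at z within S) \<and> (\<forall>c v. f' (c *s v) = c * f' v))"

text \<open>
  A polynomial map \<open>P\<close> from \<open>\<complex>\<^sup>n\<close> to \<open>\<complex>\<^sup>N\<close> is given by \<open>p i\<close> for \<open>i < N\<close>; the values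
  \<open>p i\<close> for \<open>i \<ge> N\<close> are never looked at. The rational map \<open>P/g\<close> is holomorphic on
  the unit ball if its components agree, off the zero set of the nonzero polynomial
  \<open>g\<close>, with holomorphic functions on the ball. No nonvanishing of \<open>g\<close> is
  built in.
\<close>

definition holomorphic_quotient_on_ball :: "nat \<Rightarrow> (nat \<Rightarrow> 'n::finite cpoly) \<Rightarrow> 'n cpoly \<Rightarrow> bool"
  where "holomorphic_quotient_on_ball N p g \<longleftrightarrow>
    g \<noteq> 0 \<and>
    (\<forall>i<N. \<exists>f. holomorphic_mv_on f (ball 0 1) \<and>
       (\<forall>z\<in>ball 0 1. eval_cpoly g z \<noteq> 0 \<longrightarrow> f z = eval_cpoly (p i) z / eval_cpoly g z))"

definition sphere_map :: "nat \<Rightarrow> (nat \<Rightarrow> 'n::finite cpoly) \<Rightarrow> 'n cpoly \<Rightarrow> bool"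
  where "sphere_map N p g \<longleftrightarrow>
    holomorphic_quotient_on_ball N p g \<and>
    (\<forall>z\<in>sphere 0 1. (\<Sum>i<N. (cmod (eval_cpoly (p i) z))\<^sup>2) = (cmod (eval_cpoly g z))\<^sup>2)"

definition reduced_map :: "nat \<Rightarrow> (nat \<Rightarrow> 'n::finite cpoly) \<Rightarrow> 'n cpoly \<Rightarrow> bool"
  where "reduced_map N p g \<longleftrightarrow>
    \<not> (\<exists>h. total_degree h > 0 \<and> h dvd g \<and> (\<forall>i<N. h dvd p i))"

text \<open>The degree of the rational map \<open>P/g\<close>, provided this representation is reduced.\<close>

definition rational_degree :: "nat \<Rightarrow> (nat \<Rightarrow> 'n::finite cpoly) \<Rightarrow> 'n cpoly \<Rightarrow> nat"
  where "rational_degree N p g = Max (insert (total_degree g) ((\<lambda>i. total_degree (p i)) ` {..<N}))"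

definition pointed_map :: "nat \<Rightarrow> (nat \<Rightarrow> 'n::finite cpoly) \<Rightarrow> 'n cpoly \<Rightarrow> bool"
  where "pointed_map N p g \<longleftrightarrow> eval_cpoly g 0 = 1 \<and> (\<forall>i<N. eval_cpoly (p i) 0 = 0)"

end

theory Submission
  imports Defs "HOL-Computational_Algebra.Polynomial"
begin

text \<open>
  Write \<open>q z = (\<Sum>j. z\<^sub>j\<^sup>2)\<close>, \<open>r\<^sup>2 = (\<Sum>j. \<bar>z\<^sub>j\<bar>\<^sup>2)\<close> and \<open>l = (n + 2) / 3\<close>, so that the claim
  is \<open>\<sigma>\<^sup>2 l < 1\<close>. The constant \<open>l\<close> is the squared norm of the cubic \<open>q z\<^sub>i\<close> in the inner product on
  cubic forms for which \<open>r\<^sup>6\<close> is the identity matrix; equivalently, the largest multiple of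
  \<open>\<bar>q\<bar>\<^sup>2 r\<^sup>2\<close> that can be subtracted from \<open>r\<^sup>6\<close> leaving a sum of squared moduli of cubics is \<open>1 / l\<close>.

  Let \<open>P = P\<^sub>1 + P\<^sub>2 + P\<^sub>3\<close> be the numerator split into homogeneous parts. Rotating \<open>z\<close> by unit complex
  numbers separates the sphere equation by degree difference, and homogenising gives on all of \<open>\<complex>\<^sup>n\<close>
  \<open>\<parallel>P\<^sub>1\<parallel>\<^sup>2 r\<^sup>4 + \<parallel>P\<^sub>2\<parallel>\<^sup>2 r\<^sup>2 + \<parallel>P\<^sub>3\<parallel>\<^sup>2 = r\<^sup>6 + \<sigma>\<^sup>2 \<bar>q\<bar>\<^sup>2 r\<^sup>2\<close> and
  \<open>\<langle>P\<^sub>3, P\<^sub>1\<rangle> = \<sigma> q r\<^sup>2\<close> (lemma \<open>sphere_identities\<close>).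
  Both can be polarised, that is, \<open>z\<close> and its conjugate may be treated as independent variables
  (\<open>sesqui_polarization\<close>). Hence one may apply to both sides of the first identity the functional that
  takes the trace over the span of the cubics \<open>q z\<^sub>k\<close>. Discarding \<open>P\<^sub>2\<close> and bounding the
  contribution of \<open>P\<^sub>3\<close> from below by Cauchy-Schwarz and the second identity, one finds for
  \<open>\<tau> = tr (P\<^sub>1\<^sup>* P\<^sub>1)\<close> that \<open>(\<tau> - n) (\<tau> - n \<sigma>\<^sup>2 l) \<le> 0\<close> (\<open>trace_inequalities\<close>). Evaluating the first
  identity near the isotropic vectors \<open>e\<^sub>j \<plusminus> \<i> e\<^sub>k\<close>, where \<open>q = 0\<close>, shows \<open>\<tau> \<le> n\<close>, with equality only
  if \<open>P\<^sub>1\<close> is isometric (\<open>trace_bound\<close>). In the case of equality the two identities force \<open>P\<^sub>2 = 0\<close>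
  and \<open>P\<^sub>3 = \<sigma> q P\<^sub>1\<close>, so \<open>P = g P\<^sub>1\<close> is not reduced. Otherwise \<open>\<tau> < n\<close>, and \<open>\<sigma>\<^sup>2 l \<le> \<tau> / n < 1\<close>.

  Conversely, if \<open>\<sigma>\<^sup>2 l < \<beta> < 1\<close>, a map is written down explicitly: its components are
  \<open>\<surd>\<beta> z\<^sub>i + (\<sigma> / \<surd>\<beta>) q z\<^sub>i\<close>, the harmonic projections of the \<open>z\<^sub>i z\<^sub>j z\<^sub>k\<close> scaled by \<open>\<surd>(1 - \<beta>)\<close>, and
  \<open>\<kappa> q z\<^sub>i\<close>, where \<open>\<kappa>\<^sup>2 > 0\<close> compensates the remaining multiple of \<open>\<bar>q\<bar>\<^sup>2\<close> (\<open>component_norm\<close>).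
\<close>

section \<open>Evaluation and total degree of polynomials\<close>

abbreviation monom_eval :: "('n::finite \<Rightarrow>\<^sub>0 nat) \<Rightarrow> complex ^ 'n \<Rightarrow> complex"
  where "monom_eval m z \<equiv> (\<Prod>j\<in>UNIV. (z $ j) ^ Poly_Mapping.lookup m j)"

abbreviation monom_degree :: "('n::finite \<Rightarrow>\<^sub>0 nat) \<Rightarrow> nat"
  where "monom_degree m \<equiv> (\<Sum>j\<in>UNIV. Poly_Mapping.lookup m j)"

lemma eval_cpoly_superset:
  assumes "finite S" "Poly_Mapping.keys p \<subseteq> S"
  shows "eval_cpoly p z = (\<Sum>m\<in>S. Poly_Mapping.lookup p m * monom_eval m z)"
  unfolding eval_cpoly_def
  by (rule sum.mono_neutral_left) (use assms in \<open>auto simp: in_keys_iff\<close>)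

lemma eval_cpoly_zero [simp]: "eval_cpoly 0 z = 0"
  by (simp add: eval_cpoly_def)

lemma eval_cpoly_single [simp]: "eval_cpoly (Poly_Mapping.single m c) z = c * monom_eval m z"
  by (simp add: eval_cpoly_superset[of "{m}"] keys_single)

lemma eval_cpoly_add [simp]: "eval_cpoly (p + q) z = eval_cpoly p z + eval_cpoly q z"
proof -
  let ?S = "Poly_Mapping.keys p \<union> Poly_Mapping.keys q"
  have "Poly_Mapping.keys (p + q) \<subseteq> ?S" by (rule keys_add)
  then show ?thesis
    by (simp add: eval_cpoly_superset[of ?S] lookup_add distrib_right sum.distrib)
qed

lemma eval_cpoly_sum [simp]: "eval_cpoly (sum f A) z = (\<Sum>a\<in>A. eval_cpoly (f a) z)"
  by (induction A rule: infinite_finite_induct) auto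

lemma sum_singles: "p = (\<Sum>m\<in>Poly_Mapping.keys p. Poly_Mapping.single m (Poly_Mapping.lookup p m))"
  by (rule poly_mapping_eqI)
     (auto simp: lookup_sum lookup_single when_def in_keys_iff sum.delta)

lemma eval_cpoly_mult [simp]: "eval_cpoly (p * q) z = eval_cpoly p z * eval_cpoly q z"
proof -
  let ?s = "\<lambda>p m. Poly_Mapping.single m (Poly_Mapping.lookup p m)"
  have "eval_cpoly (p * q) z =
      eval_cpoly ((\<Sum>m\<in>Poly_Mapping.keys p. ?s p m) * (\<Sum>m\<in>Poly_Mapping.keys q. ?s q m)) z"
    by (simp flip: sum_singles)
  also have "\<dots> = (\<Sum>m\<in>Poly_Mapping.keys p. eval_cpoly (?s p m) z) *
      (\<Sum>m\<in>Poly_Mapping.keys q. eval_cpoly (?s q m) z)"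
    by (simp add: sum_product mult_single lookup_add power_add prod.distrib mult_ac)
  also have "\<dots> = eval_cpoly p z * eval_cpoly q z"
    by (simp only: eval_cpoly_single) (simp add: eval_cpoly_def)
  finally show ?thesis .
qed

lemma eval_cpoly_Cst [simp]: "eval_cpoly (Cst c) z = c"
  by (simp add: Cst_def)

lemma eval_cpoly_one [simp]: "eval_cpoly 1 z = 1"
  by (simp flip: single_one)

lemma eval_cpoly_Var [simp]: "eval_cpoly (Var j) z = z $ j"
proof -
  have "monom_eval (Poly_Mapping.single j 1) z = (\<Prod>i\<in>UNIV. if i = j then z $ i else 1)"
    by (rule prod.cong) (auto simp: lookup_single when_def)
  then show ?thesis by (simp add: Var_def prod.delta)
qed

lemma eval_cpoly_power [simp]: "eval_cpoly (p ^ k) z = eval_cpoly p z ^ k"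
  by (induction k) auto

lemma eval_cpoly_uminus [simp]: "eval_cpoly (- p) z = - eval_cpoly p z"
  using eval_cpoly_add[of p "-p" z] by (simp add: eq_neg_iff_add_eq_0 add.commute)

lemma eval_cpoly_diff [simp]: "eval_cpoly (p - q) z = eval_cpoly p z - eval_cpoly q z"
  using eval_cpoly_add[of p "-q" z] by simp

lemma poly_coeffs_zero:
  fixes c :: "nat \<Rightarrow> complex"
  assumes "finite D" "\<And>t. (\<Sum>d\<in>D. c d * t ^ d) = 0" "d \<in> D"
  shows "c d = 0"
proof -
  define q where "q = (\<Sum>d\<in>D. Polynomial.monom (c d) d)"
  have "poly q t = 0" for t
    using assms(2)[of t] by (simp add: q_def poly_sum poly_monom)
  then have "q = 0" using poly_all_0_iff_0[of q] by blast
  then have "poly.coeff q d = 0" by simp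
  then show ?thesis using assms(1,3)
    by (simp add: q_def coeff_sum if_distrib sum.delta cong: if_cong)
qed

text \<open>
  Induction on the variables: sorting the monomials by their exponent in one variable gives
  a polynomial identity in that variable alone, whose coefficients involve only the other ones.
\<close>

lemma monomials_independent:
  fixes K :: "('n::finite \<Rightarrow>\<^sub>0 nat) set" and c :: "('n \<Rightarrow>\<^sub>0 nat) \<Rightarrow> complex"
  assumes "finite J" "finite K"
    and "\<And>m m'. m \<in> K \<Longrightarrow> m' \<in> K \<Longrightarrow>
           (\<And>j. j \<in> J \<Longrightarrow> Poly_Mapping.lookup m j = Poly_Mapping.lookup m' j) \<Longrightarrow> m = m'"
    and "\<And>z :: complex ^ 'n. (\<Sum>m\<in>K. c m * (\<Prod>j\<in>J. (z $ j) ^ Poly_Mapping.lookup m j)) = 0"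
    and "m \<in> K"
  shows "c m = 0"
  using assms
proof (induction J arbitrary: K m rule: finite_induct)
  case empty
  then have "K = {m}" by auto
  then show ?case using empty.prems(3)[of undefined] by simp
next
  case (insert i J)
  let ?e = "\<lambda>m. Poly_Mapping.lookup m i"
  let ?r = "\<lambda>m z. \<Prod>j\<in>J. (z $ j) ^ Poly_Mapping.lookup m j"
  define K' where "K' = {m' \<in> K. ?e m' = ?e m}"
  have *: "(\<Sum>m\<in>K'. c m * ?r m z) = 0" for z :: "complex ^ 'n"
  proof -
    have "(\<Sum>d\<in>?e ` K. (\<Sum>m | m \<in> K \<and> ?e m = d. c m * ?r m z) * t ^ d) = 0" for t
    proof -
      define y :: "complex ^ 'n" where "y = (\<chi> j. if j = i then t else z $ j)"
      have "?r m y = ?r m z" for m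
        using insert.hyps(2) by (intro prod.cong) (auto simp: y_def)
      then have y: "(\<Prod>j\<in>insert i J. (y $ j) ^ Poly_Mapping.lookup m j) = t ^ ?e m * ?r m z" for m
        using insert.hyps by (simp add: y_def)
      have "(\<Sum>d\<in>?e ` K. (\<Sum>m | m \<in> K \<and> ?e m = d. c m * ?r m z) * t ^ d)
          = (\<Sum>d\<in>?e ` K. \<Sum>m | m \<in> K \<and> ?e m = d. c m * (t ^ ?e m * ?r m z))"
        unfolding sum_distrib_right by (intro sum.cong refl) (auto simp: mult_ac)
      also have "\<dots> = (\<Sum>m\<in>K. c m * (t ^ ?e m * ?r m z))"
        by (rule sum.image_gen[symmetric]) fact
      also have "\<dots> = 0"
        using insert.prems(3)[of y] by (simp only: y)
      finally show ?thesis .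
    qed
    then have "(\<Sum>m' | m' \<in> K \<and> ?e m' = ?e m. c m' * ?r m' z) = 0"
      by (intro poly_coeffs_zero[where D = "?e ` K" and d = "?e m"
            and c = "\<lambda>d. \<Sum>m | m \<in> K \<and> ?e m = d. c m * ?r m z"])
         (use insert.prems in auto)
    then show ?thesis by (simp add: K'_def)
  qed
  show ?case
  proof (rule insert.IH[of K'])
    show "m1 = m2" if "m1 \<in> K'" "m2 \<in> K'"
      "\<And>j. j \<in> J \<Longrightarrow> Poly_Mapping.lookup m1 j = Poly_Mapping.lookup m2 j" for m1 m2
    proof (rule insert.prems(2))
      show "Poly_Mapping.lookup m1 j = Poly_Mapping.lookup m2 j" if "j \<in> insert i J" for j
        using that \<open>m1 \<in> K'\<close> \<open>m2 \<in> K'\<close> 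
          \<open>\<And>j. j \<in> J \<Longrightarrow> Poly_Mapping.lookup m1 j = Poly_Mapping.lookup m2 j\<close>
        by (cases "j = i") (simp_all add: K'_def)
    qed (use that in \<open>simp_all add: K'_def\<close>)
  qed (use insert.prems * in \<open>auto simp: K'_def\<close>)
qed

lemma eval_cpoly_eq_0D:
  assumes "\<And>z. eval_cpoly p z = 0"
  shows "p = 0"
proof (rule ccontr)
  assume "p \<noteq> 0"
  then obtain m where m: "m \<in> Poly_Mapping.keys p"
    by (metis keys_eq_empty equals0I)
  have "Poly_Mapping.lookup p m = 0"
    by (rule monomials_independent[of UNIV "Poly_Mapping.keys p"])
       (use m assms in \<open>auto simp: eval_cpoly_def intro: poly_mapping_eqI\<close>)
  then show False using m by (simp add: in_keys_iff)
qed

lemma eval_cpoly_inject: "(\<And>z. eval_cpoly p z = eval_cpoly q z) \<Longrightarrow> p = q"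
  using eval_cpoly_eq_0D[of "p - q"] by simp

lemma total_degree_le_iff:
  "total_degree p \<le> d \<longleftrightarrow> (\<forall>m\<in>Poly_Mapping.keys p. monom_degree m \<le> d)"
  by (auto simp: total_degree_def)

lemma total_degree_add_le:
  "total_degree p \<le> d \<Longrightarrow> total_degree q \<le> d \<Longrightarrow> total_degree (p + q) \<le> d"
  using keys_add[of p q] by (auto simp: total_degree_le_iff)

lemma total_degree_sum_le:
  "(\<And>a. a \<in> A \<Longrightarrow> total_degree (f a) \<le> d) \<Longrightarrow> total_degree (sum f A) \<le> d"
  by (induction A rule: infinite_finite_induct)
     (auto intro!: total_degree_add_le simp: total_degree_le_iff[of 0])

lemma total_degree_mult_le:
  assumes "total_degree p \<le> a" "total_degree q \<le> b"
  shows "total_degree (p * q) \<le> a + b"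
proof -
  have "monom_degree m \<le> a + b" if "m \<in> Poly_Mapping.keys (p * q)" for m
  proof -
    from that keys_mult[of p q] have "m \<in> {k + l |k l. k \<in> Poly_Mapping.keys p \<and> l \<in> Poly_Mapping.keys q}"
      by (rule subsetD[rotated])
    then show ?thesis using assms
      by (auto simp: total_degree_le_iff lookup_add sum.distrib add_mono)
  qed
  then show ?thesis by (simp add: total_degree_le_iff)
qed

lemma total_degree_Cst [simp]: "total_degree (Cst c) = 0"
proof -
  have "total_degree (Cst c) \<le> 0"
    unfolding total_degree_le_iff by (simp add: Cst_def keys_single)
  then show ?thesis by simp
qed

lemma total_degree_one [simp]: "total_degree 1 = 0"
  using total_degree_Cst[of 1] by (simp add: Cst_def)

lemma total_degree_Var_le: "total_degree (Var j) \<le> 1"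
  by (simp add: total_degree_le_iff Var_def keys_single lookup_single when_def sum.delta)

lemma eval_cpoly_along_line:
  assumes "total_degree p \<le> d"
  obtains r :: "complex poly"
  where "degree r \<le> d" "\<And>t. poly r t = eval_cpoly p (t *s z)"
proof
  let ?r = "\<Sum>m\<in>Poly_Mapping.keys p.
              Polynomial.monom (Poly_Mapping.lookup p m * monom_eval m z) (monom_degree m)"
  show "degree ?r \<le> d"
    using assms by (intro degree_sum_le) (auto simp: total_degree_le_iff intro: order.trans[OF degree_monom_le])
  show "poly ?r t = eval_cpoly p (t *s z)" for t
    by (simp add: poly_sum poly_monom eval_cpoly_def power_mult_distrib prod.distrib power_sum mult_ac)
qed

lemma total_degree_zeroD:
  assumes "total_degree p = 0"
  shows "eval_cpoly p z = eval_cpoly p 0"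
proof -
  obtain r :: "complex poly" where r: "degree r \<le> 0" "\<And>t. poly r t = eval_cpoly p (t *s z)"
    by (rule eval_cpoly_along_line[of p 0]) (use assms in auto)
  from r(1) obtain a where "r = [:a:]" by (auto elim: degree_eq_zeroE)
  with r(2)[of 0] r(2)[of 1] show ?thesis by simp
qed

section \<open>Polarisation\<close>

lemma poly_zero_on_circle:
  fixes p :: "complex poly"
  assumes "\<And>t. cmod t = 1 \<Longrightarrow> poly p t = 0"
  shows "p = 0"
proof (rule ccontr)
  assume "p \<noteq> 0"
  then have "finite {t. poly p t = 0}" by (rule poly_roots_finite)
  moreover have "sphere (0::complex) 1 \<subseteq> {t. poly p t = 0}"
    using assms by (auto simp: dist_norm)
  moreover have "infinite (sphere (0::complex) 1)"
  proof -
    have "inj_on (\<lambda>x. Complex x (sqrt (1 - x\<^sup>2))) {0..1}" by (auto intro: inj_onI)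
    then have "infinite ((\<lambda>x. Complex x (sqrt (1 - x\<^sup>2))) ` {0..1})"
      by (subst finite_image_iff) auto
    moreover have "(\<lambda>x. Complex x (sqrt (1 - x\<^sup>2))) ` {0..1} \<subseteq> sphere 0 1"
      by (auto simp: cmod_def abs_square_le_1)
    ultimately show ?thesis using finite_subset by blast
  qed
  ultimately show False using finite_subset by blast
qed

text \<open>
  The class of \<open>H z w\<close> that are polynomial in \<open>z\<close> and homogeneous of degree \<open>e\<close> in the conjugate of
  \<open>w\<close> is captured through one complex parameter. Along \<open>z + t w\<close> with \<open>\<bar>t\<bar> = 1\<close> the conjugate
  of \<open>t\<close> is \<open>1 / t\<close>, so multiplication by \<open>t\<^sup>e\<close> clears denominators; the value at \<open>t = 0\<close> then picks
  \<open>z\<close> from the holomorphic factors and \<open>w\<close> from the conjugated ones. In this form the class is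
  visibly closed under sums and products, and no expansion into monomials is needed.
\<close>

definition sesqui :: "nat \<Rightarrow> (complex ^ 'n::finite \<Rightarrow> complex ^ 'n \<Rightarrow> complex) \<Rightarrow> bool"
  where "sesqui e H \<longleftrightarrow> (\<forall>z w. \<exists>p. poly p 0 = H z w \<and>
           (\<forall>t. cmod t = 1 \<longrightarrow> poly p t = t ^ e * H (z + t *s w) (z + t *s w)))"

lemma sesqui_const: "sesqui 0 (\<lambda>z w. c)"
  unfolding sesqui_def by (auto intro: exI[of _ "[:c:]"])

lemma sesqui_component: "sesqui 0 (\<lambda>z w :: complex ^ 'n::finite. z $ j)"
  unfolding sesqui_def
proof (intro allI)
  fix z w :: "complex ^ 'n"
  show "\<exists>p. poly p 0 = z $ j \<and>
           (\<forall>t. cmod t = 1 \<longrightarrow> poly p t = t ^ 0 * (z + t *s w) $ j)"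
    by (rule exI[of _ "[:z $ j, w $ j:]"]) simp
qed

lemma sesqui_cnj_component: "sesqui 1 (\<lambda>z w :: complex ^ 'n::finite. cnj (w $ j))"
  unfolding sesqui_def
proof (intro allI)
  fix z w :: "complex ^ 'n"
  have *: "t * cnj t = 1" if "cmod t = 1" for t
    using that by (simp add: complex_norm_square[symmetric] flip: of_real_power)
  have "poly [:cnj (w $ j), cnj (z $ j):] t = t ^ 1 * cnj ((z + t *s w) $ j)" if "cmod t = 1" for t
    using *[OF that] by (simp add: algebra_simps)
  then show "\<exists>p. poly p 0 = cnj (w $ j) \<and>
           (\<forall>t. cmod t = 1 \<longrightarrow> poly p t = t ^ 1 * cnj ((z + t *s w) $ j))"
    by (intro exI[of _ "[:cnj (w $ j), cnj (z $ j):]"]) simp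
qed

lemma sesqui_add:
  assumes "sesqui e F" "sesqui e G"
  shows "sesqui e (\<lambda>z w. F z w + G z w)"
  unfolding sesqui_def
proof (intro allI)
  fix z w
  obtain p q where "poly p 0 = F z w" "poly q 0 = G z w"
    "\<forall>t. cmod t = 1 \<longrightarrow> poly p t = t ^ e * F (z + t *s w) (z + t *s w)"
    "\<forall>t. cmod t = 1 \<longrightarrow> poly q t = t ^ e * G (z + t *s w) (z + t *s w)"
    using assms unfolding sesqui_def by metis
  then show "\<exists>p. poly p 0 = F z w + G z w \<and> (\<forall>t. cmod t = 1 \<longrightarrow>
      poly p t = t ^ e * (F (z + t *s w) (z + t *s w) + G (z + t *s w) (z + t *s w)))"
    by (intro exI[of _ "p + q"]) (auto simp: algebra_simps)
qed

lemma sesqui_mult: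
  assumes "sesqui d F" "sesqui e G"
  shows "sesqui (d + e) (\<lambda>z w. F z w * G z w)"
  unfolding sesqui_def
proof (intro allI)
  fix z w
  obtain p q where "poly p 0 = F z w" "poly q 0 = G z w"
    "\<forall>t. cmod t = 1 \<longrightarrow> poly p t = t ^ d * F (z + t *s w) (z + t *s w)"
    "\<forall>t. cmod t = 1 \<longrightarrow> poly q t = t ^ e * G (z + t *s w) (z + t *s w)"
    using assms unfolding sesqui_def by metis
  then show "\<exists>p. poly p 0 = F z w * G z w \<and> (\<forall>t. cmod t = 1 \<longrightarrow>
      poly p t = t ^ (d + e) * (F (z + t *s w) (z + t *s w) * G (z + t *s w) (z + t *s w)))"
    by (intro exI[of _ "p * q"]) (auto simp: algebra_simps power_add)
qed

lemma sesqui_mult':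
  "sesqui d F \<Longrightarrow> sesqui e G \<Longrightarrow> d + e = f \<Longrightarrow> sesqui f (\<lambda>z w. F z w * G z w)"
  using sesqui_mult by blast

lemma sesqui_zero: "sesqui e (\<lambda>z w. 0)"
  unfolding sesqui_def by (auto intro: exI[of _ 0])

lemma sesqui_sum: "(\<And>i. i \<in> A \<Longrightarrow> sesqui e (F i)) \<Longrightarrow> sesqui e (\<lambda>z w. \<Sum>i\<in>A. F i z w)"
  by (induction A rule: infinite_finite_induct) (auto intro: sesqui_add sesqui_zero)

lemma sesqui_prod:
  "(\<And>i. i \<in> A \<Longrightarrow> sesqui (e i) (F i)) \<Longrightarrow> sesqui (\<Sum>i\<in>A. e i) (\<lambda>z w. \<Prod>i\<in>A. F i z w)"
  by (induction A rule: infinite_finite_induct) (auto intro: sesqui_mult sesqui_const)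

lemma sesqui_power: "sesqui e F \<Longrightarrow> sesqui (k * e) (\<lambda>z w. F z w ^ k)"
  using sesqui_prod[of "{..<k}" "\<lambda>_. e" "\<lambda>_. F"] by simp

lemma sesqui_cmult: "sesqui e F \<Longrightarrow> sesqui e (\<lambda>z w. c * F z w)"
  using sesqui_mult[OF sesqui_const, of e F c] by simp

lemma sesqui_diff:
  "sesqui e F \<Longrightarrow> sesqui e G \<Longrightarrow> sesqui e (\<lambda>z w. F z w - G z w)"
  using sesqui_add[of e F "\<lambda>z w. (-1) * G z w"] sesqui_cmult[of e G "-1"] by simp

text \<open>
  Vanishing on the diagonal makes the polynomial in \<open>t\<close> vanish on the whole unit circle, hence
  also at \<open>t = 0\<close>.
\<close>

lemma sesqui_polarization:
  assumes "sesqui e H" "\<And>z. H z z = 0"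
  shows "H z w = 0"
proof -
  obtain p where p: "poly p 0 = H z w"
    "\<And>t. cmod t = 1 \<Longrightarrow> poly p t = t ^ e * H (z + t *s w) (z + t *s w)"
    using assms(1) unfolding sesqui_def by metis
  then have "p = 0" using assms(2) by (intro poly_zero_on_circle) simp
  with p(1) show ?thesis by simp
qed

section \<open>Homogeneous parts\<close>

definition hpart :: "nat \<Rightarrow> 'n::finite cpoly \<Rightarrow> complex ^ 'n \<Rightarrow> complex"
  where "hpart d p z = (\<Sum>m | m \<in> Poly_Mapping.keys p \<and> monom_degree m = d.
           Poly_Mapping.lookup p m * monom_eval m z)"

lemma hpart_scale: "hpart d p (t *s z) = t ^ d * hpart d p z"
  by (auto simp: hpart_def power_mult_distrib prod.distrib sum_distrib_left mult_ac
      simp flip: power_sum intro!: sum.cong)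

lemma sesqui_hpart: "sesqui 0 (\<lambda>z w. hpart d p z)"
proof -
  have "sesqui 0 (\<lambda>z w. monom_eval m z)" for m
    using sesqui_prod[of UNIV "\<lambda>_. 0" "\<lambda>j z w. (z $ j) ^ Poly_Mapping.lookup m j"]
      sesqui_power[OF sesqui_component, of "Poly_Mapping.lookup m j" j for j] by simp
  then show ?thesis unfolding hpart_def by (intro sesqui_sum sesqui_cmult) simp
qed

lemma sesqui_cnj_hpart: "sesqui d (\<lambda>z w. cnj (hpart d p w))"
proof -
  have "sesqui (monom_degree m) (\<lambda>z w. cnj (monom_eval m w))" for m
    using sesqui_prod[of UNIV "Poly_Mapping.lookup m"
        "\<lambda>j z w. cnj (w $ j) ^ Poly_Mapping.lookup m j"]
      sesqui_power[OF sesqui_cnj_component, of "Poly_Mapping.lookup m j" j for j] by simp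
  then show ?thesis unfolding hpart_def
    by (auto simp: intro!: sesqui_sum sesqui_cmult)
qed

lemma eval_cpoly_hparts:
  assumes "total_degree p \<le> 3" "eval_cpoly p 0 = 0"
  shows "eval_cpoly p z = hpart 1 p z + hpart 2 p z + hpart 3 p z"
proof -
  have "eval_cpoly p z = (\<Sum>d\<in>{0..3}. hpart d p z)" for z
    unfolding eval_cpoly_def hpart_def
    by (rule sum.group[symmetric]) (use assms in \<open>auto simp: total_degree_le_iff\<close>)
  moreover have "{0..3} = {0,1,2,3::nat}" by auto
  ultimately have e: "eval_cpoly p z = hpart 0 p z + hpart 1 p z + hpart 2 p z + hpart 3 p z" for z
    by (simp add: add_ac)
  have "hpart 0 p z = hpart 0 p 0"
    using hpart_scale[of 0 p 0 z] by simp
  moreover have "hpart d p 0 = 0" if "d > 0" for d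
    using hpart_scale[of d p 0 0] that by (simp add: power_0_left)
  ultimately show ?thesis using e[of z] e[of 0] assms(2) by simp
qed

lemma hpart_1:
  fixes p :: "'n::finite cpoly"
  obtains a where "\<And>z. hpart 1 p z = (\<Sum>j\<in>UNIV. a j * z $ j)"
proof
  fix z :: "complex ^ 'n"
  have "monom_eval m z = (\<Sum>j\<in>UNIV. of_nat (Poly_Mapping.lookup m j) * z $ j)"
    if "monom_degree m = 1" for m
  proof -
    have "\<exists>i. Poly_Mapping.lookup m i = 1 \<and> (\<forall>j. i \<noteq> j \<longrightarrow> Poly_Mapping.lookup m j = 0)"
      using that unfolding sum_eq_1_iff[OF finite] by auto
    then obtain i where i: "Poly_Mapping.lookup m i = 1"
        "\<And>j. j \<noteq> i \<Longrightarrow> Poly_Mapping.lookup m j = 0" by metis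
    have "monom_eval m z = (\<Prod>j\<in>UNIV. if j = i then z $ j else 1)"
      using i by (intro prod.cong) auto
    moreover have "(\<Sum>j\<in>UNIV. of_nat (Poly_Mapping.lookup m j) * z $ j)
        = (\<Sum>j\<in>UNIV. if j = i then z $ j else 0)"
      using i by (intro sum.cong) auto
    ultimately show ?thesis by simp
  qed
  then show "hpart 1 p z = (\<Sum>j\<in>UNIV. (\<Sum>m | m \<in> Poly_Mapping.keys p \<and> monom_degree m = 1.
      Poly_Mapping.lookup p m * of_nat (Poly_Mapping.lookup m j)) * z $ j)"
    unfolding hpart_def sum_distrib_right
    by (subst sum.swap) (auto simp: sum_distrib_left mult_ac intro!: sum.cong)
qed

section \<open>Contraction of cubic forms\<close>

text \<open>
  For a cubic form \<open>f z = (\<Sum>a b c. T a b c z\<^sub>a z\<^sub>b z\<^sub>c)\<close> with symmetric \<open>T\<close> this is \<open>(\<Sum>i. T i i k)\<close>, up to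
  a constant the coefficient of \<open>z\<^sub>k\<close> in the Laplacian of \<open>f\<close>, or the inner product of \<open>f\<close> with
  \<open>q z\<^sub>k\<close>. It is written through point evaluations, so that it is linear on arbitrary functions and
  needs no choice of coefficients: for \<open>i \<noteq> k\<close>, \<open>T i i k\<close> is one third of the coefficient of \<open>t\<close> in
  \<open>f (e\<^sub>i + t e\<^sub>k)\<close>, recovered from the values at \<open>t = 1\<close> and \<open>t = -1\<close> and the coefficient
  \<open>f e\<^sub>k\<close> of \<open>t\<^sup>3\<close>.
\<close>

definition contr :: "'n::finite \<Rightarrow> (complex ^ 'n \<Rightarrow> complex) \<Rightarrow> complex"
  where "contr k f = (\<Sum>i\<in>UNIV. if i = k then f (axis k 1)
           else ((f (axis i 1 + axis k 1) - f (axis i 1 - axis k 1)) / 2 - f (axis k 1)) / 3)"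

lemma contr_zero [simp]: "contr k (\<lambda>z. 0) = 0"
  by (simp add: contr_def cong: if_cong)

lemma contr_add: "contr k (\<lambda>z. f z + g z) = contr k f + contr k g"
  unfolding contr_def sum.distrib[symmetric]
  by (intro sum.cong refl) (auto simp: field_simps)

lemma contr_cmult: "contr k (\<lambda>z. c * f z) = c * contr k f"
  unfolding contr_def sum_distrib_left
  by (intro sum.cong refl) (auto simp: field_simps)

lemma contr_cmult_right: "contr k (\<lambda>z. f z * c) = contr k f * c"
  using contr_cmult[of k c f] by (simp add: mult.commute)

lemma contr_sum: "contr k (\<lambda>z. \<Sum>a\<in>A. f a z) = (\<Sum>a\<in>A. contr k (f a))"
  by (induction A rule: infinite_finite_induct) (simp_all add: contr_add)

lemma contr_cnj: "contr k (\<lambda>z. cnj (f z)) = cnj (contr k f)"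
  unfolding contr_def cnj_sum by (intro sum.cong refl) auto

definition lin :: "('n::finite \<Rightarrow> complex) \<Rightarrow> complex ^ 'n \<Rightarrow> complex"
  where "lin x z = (\<Sum>j\<in>UNIV. x j * z $ j)"

lemma lin_axis: "lin x (axis i 1) = x i"
  by (simp add: lin_def axis_def if_distrib cong: if_cong)

lemma lin_add: "lin x (z + w) = lin x z + lin x w"
  by (simp add: lin_def algebra_simps sum.distrib)

lemma lin_diff: "lin x (z - w) = lin x z - lin x w"
  by (simp add: lin_def algebra_simps sum_subtractf)

text \<open>
  The symmetrised tensor of three linear forms, contracted. A linear form takes the value
  \<open>x\<^sub>i \<plusminus> x\<^sub>k\<close> at \<open>e\<^sub>i \<plusminus> e\<^sub>k\<close>, which makes this an identity of the summands for each \<open>i\<close>.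
\<close>

lemma contr_lin_product:
  "contr k (\<lambda>z. lin x z * lin y z * lin u z) =
     ((\<Sum>i\<in>UNIV. x i * y i) * u k + (\<Sum>i\<in>UNIV. x i * u i) * y k + (\<Sum>i\<in>UNIV. y i * u i) * x k) / 3"
  unfolding contr_def lin_add lin_diff lin_axis sum_distrib_right sum.distrib[symmetric] sum_divide_distrib
  by (intro sum.cong refl) (auto simp: field_simps)

definition kron :: "'n \<Rightarrow> 'n \<Rightarrow> complex"
  where "kron i j = (if i = j then 1 else 0)"

lemma kron_sum [simp]:
  "(\<Sum>j\<in>UNIV. kron i j * f j) = f i" "(\<Sum>j\<in>UNIV. kron j i * f j) = f i"
  "(\<Sum>j\<in>UNIV. f j * kron i j) = f i" "(\<Sum>j\<in>UNIV. f j * kron j i) = f (i::'n::finite)"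
  by (simp_all add: kron_def if_distrib[of "\<lambda>x. x * _"] if_distrib[of "\<lambda>x. _ * x"] cong: if_cong)

lemma kron_simps [simp]: "kron i i = 1" "cnj (kron i j) = kron i j" "kron i j * kron i j = kron i j"
  by (simp_all add: kron_def)

lemma kron_commute: "kron i j = kron j i" by (simp add: kron_def)

lemma lin_kron: "lin (kron i) z = z $ i"
  by (simp add: lin_def)

lemma contr_monomial:
  "contr k (\<lambda>z. z $ i * z $ j * lin x z) = (kron i j * x k + kron i k * x j + kron j k * x i) / 3"
  using contr_lin_product[of k "kron i" "kron j" x]
  by (simp add: lin_kron kron_commute[of j i] mult_ac)

text \<open>
  The square of each of the three terms sums to \<open>n \<parallel>x\<parallel>\<^sup>2\<close>, and each of the six mixed products
  to \<open>\<parallel>x\<parallel>\<^sup>2\<close>. The identity is used both for the trace in the necessity proof and for the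
  norm of the harmonic projection in the construction.
\<close>

lemma kron_tensor_norm:
  fixes x :: "'n::finite \<Rightarrow> complex"
  shows "(\<Sum>i\<in>UNIV. \<Sum>j\<in>UNIV. \<Sum>k\<in>UNIV.
      (cmod (kron i j * x k + kron i k * x j + kron j k * x i))\<^sup>2) =
      3 * (real CARD('n) + 2) * (\<Sum>j\<in>UNIV. (cmod (x j))\<^sup>2)" (is "?L = ?R")
proof -
  let ?n = "of_nat CARD('n) :: complex"
  have e: "complex_of_real ((cmod (kron i j * x k + kron i k * x j + kron j k * x i))\<^sup>2) =
     kron i j * (x k * cnj (x k)) + kron i k * (x j * cnj (x j)) + kron j k * (x i * cnj (x i))
     + kron i j * (kron i k * (x k * cnj (x j))) + kron i j * (kron i k * (x j * cnj (x k)))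
     + kron i j * (kron j k * (x k * cnj (x i))) + kron i j * (kron j k * (x i * cnj (x k)))
     + kron i k * (kron j k * (x j * cnj (x i))) + kron i k * (kron j k * (x i * cnj (x j)))" for i j k
    by (simp add: complex_norm_square kron_def algebra_simps del: of_real_power)
  have "complex_of_real ?L = (3 * ?n + 6) * (\<Sum>j\<in>UNIV. x j * cnj (x j))"
    unfolding of_real_sum e
    by (simp only: sum.distrib sum_distrib_left[symmetric] kron_sum sum_constant)
       (simp add: sum_distrib_left algebra_simps flip: sum.distrib)
  also have "\<dots> = complex_of_real ?R"
    by (simp add: complex_norm_square algebra_simps del: of_real_power)
  finally have "complex_of_real ?L = complex_of_real ?R" .
  then show ?thesis by (simp only: of_real_eq_iff)
qed

text \<open>
  Contracting in both arguments and summing turns a Hermitian form on cubics into its trace over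
  the span of the \<open>q z\<^sub>k\<close>, up to a constant factor; on \<open>\<bar>f\<bar>\<^sup>2\<close> it is manifestly nonnegative.
\<close>

definition dcontr :: "(complex ^ 'n::finite \<Rightarrow> complex ^ 'n \<Rightarrow> complex) \<Rightarrow> complex"
  where "dcontr H = (\<Sum>k\<in>UNIV. contr k (\<lambda>z. contr k (\<lambda>w. H z w)))"

lemma dcontr_add: "dcontr (\<lambda>z w. F z w + G z w) = dcontr F + dcontr G"
  by (simp add: dcontr_def contr_add sum.distrib)

lemma dcontr_cmult: "dcontr (\<lambda>z w. c * F z w) = c * dcontr F"
  by (simp add: dcontr_def contr_cmult sum_distrib_left)

lemma dcontr_squares:
  "dcontr (\<lambda>z w. \<Sum>s\<in>A. f s z * cnj (f s w)) = of_real (\<Sum>k\<in>UNIV. \<Sum>s\<in>A. (cmod (contr k (f s)))\<^sup>2)"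
  by (simp add: dcontr_def contr_sum contr_cmult contr_cmult_right contr_cnj
      complex_norm_square mult.commute del: of_real_power)

definition herm :: "complex ^ 'n::finite \<Rightarrow> complex ^ 'n \<Rightarrow> complex"
  where "herm z w = (\<Sum>j\<in>UNIV. z $ j * cnj (w $ j))"

definition quad :: "complex ^ 'n::finite \<Rightarrow> complex"
  where "quad z = (\<Sum>j\<in>UNIV. (z $ j)\<^sup>2)"

lemma contr_quad:
  "contr k (\<lambda>z :: complex ^ 'n::finite. quad z * z $ i) = (of_nat CARD('n) + 2) / 3 * kron i k"
proof -
  have "(\<lambda>z :: complex ^ 'n. quad z * z $ i) = (\<lambda>z. \<Sum>j\<in>UNIV. z $ j * z $ j * lin (kron i) z)"
    by (simp add: quad_def sum_distrib_right power2_eq_square lin_kron del: kron_sum)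
  then have "contr k (\<lambda>z :: complex ^ 'n. quad z * z $ i)
      = (\<Sum>j\<in>UNIV. (kron i k + kron j k * kron i j + kron j k * kron i j) / 3)"
    by (simp only: contr_sum contr_monomial kron_simps) simp
  also have "\<dots> = (of_nat CARD('n) + 2) / 3 * kron i k"
    by (simp add: sum.distrib flip: sum_divide_distrib sum_distrib_left) (simp add: field_simps)
  finally show ?thesis .
qed

lemma dcontr_linear_squares:
  "dcontr (\<lambda>z w :: complex ^ 'n::finite. \<Sum>s\<in>A. lin (a s) z * cnj (lin (a s) w) * herm z w ^ 2) =
     of_real ((real CARD('n) + 2) / 3 * (\<Sum>s\<in>A. \<Sum>j\<in>UNIV. (cmod (a s j))\<^sup>2))"
proof -
  have "(\<lambda>z w :: complex ^ 'n. \<Sum>s\<in>A. lin (a s) z * cnj (lin (a s) w) * herm z w ^ 2) =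
    (\<lambda>z w. \<Sum>s\<in>A. \<Sum>i\<in>UNIV. \<Sum>j\<in>UNIV. (z $ i * z $ j * lin (a s) z) * cnj (w $ i * w $ j * lin (a s) w))"
    by (intro ext sum.cong refl)
       (simp add: herm_def power2_eq_square sum_product sum_distrib_left mult_ac)
  also have "\<dots> = (\<lambda>z w. \<Sum>(s, i, j)\<in>A \<times> UNIV \<times> UNIV.
      (z $ i * z $ j * lin (a s) z) * cnj (w $ i * w $ j * lin (a s) w))"
    by (simp only: sum.cartesian_product)
  finally have "dcontr (\<lambda>z w :: complex ^ 'n. \<Sum>s\<in>A. lin (a s) z * cnj (lin (a s) w) * herm z w ^ 2)
     = of_real (\<Sum>k\<in>UNIV. \<Sum>(s, i, j)\<in>A \<times> UNIV \<times> UNIV.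
        (cmod (contr k (\<lambda>z. z $ i * z $ j * lin (a s) z)))\<^sup>2)"
    by (simp only: dcontr_squares[of "\<lambda>(s, i, j) z. z $ i * z $ j * lin (a s) z",
           simplified case_prod_unfold] case_prod_unfold)
  also have "(\<Sum>k\<in>UNIV. \<Sum>(s, i, j)\<in>A \<times> UNIV \<times> UNIV.
        (cmod (contr k (\<lambda>z. z $ i * z $ j * lin (a s) z)))\<^sup>2)
     = (\<Sum>s\<in>A. \<Sum>i\<in>UNIV. \<Sum>j\<in>UNIV. \<Sum>k\<in>UNIV. (cmod (contr k (\<lambda>z. z $ i * z $ j * lin (a s) z)))\<^sup>2)"
  proof -
    have "(\<Sum>k\<in>UNIV. \<Sum>(s, i, j)\<in>A \<times> UNIV \<times> UNIV.
        (cmod (contr k (\<lambda>z. z $ i * z $ j * lin (a s) z)))\<^sup>2)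
      = (\<Sum>(s, i, j)\<in>A \<times> UNIV \<times> UNIV. \<Sum>k\<in>UNIV.
        (cmod (contr k (\<lambda>z. z $ i * z $ j * lin (a s) z)))\<^sup>2)"
      by (subst sum.swap) (simp only: case_prod_unfold)
    then show ?thesis by (simp only: sum.cartesian_product[symmetric])
  qed
  also have "\<dots> = (\<Sum>s\<in>A. (real CARD('n) + 2) / 3 * (\<Sum>j\<in>UNIV. (cmod (a s j))\<^sup>2))"
  proof (rule sum.cong[OF refl])
    fix s
    have "(\<Sum>i\<in>UNIV. \<Sum>j\<in>UNIV. \<Sum>k\<in>UNIV. (cmod (contr k (\<lambda>z. z $ i * z $ j * lin (a s) z)))\<^sup>2) =
      (\<Sum>i\<in>UNIV. \<Sum>j\<in>UNIV. \<Sum>k\<in>UNIV. (cmod (kron i j * a s k + kron i k * a s j + kron j k * a s i))\<^sup>2) / 9"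
      by (simp only: contr_monomial norm_divide power_divide sum_divide_distrib) simp
    then show "(\<Sum>i\<in>UNIV. \<Sum>j\<in>UNIV. \<Sum>k\<in>UNIV. (cmod (contr k (\<lambda>z. z $ i * z $ j * lin (a s) z)))\<^sup>2) =
       (real CARD('n) + 2) / 3 * (\<Sum>j\<in>UNIV. (cmod (a s j))\<^sup>2)"
      by (simp only: kron_tensor_norm)
  qed
  finally show ?thesis by (simp only: sum_distrib_left)
qed

section \<open>The homogeneous identities of a cubic sphere map\<close>

lemma cnj_unit_circle: "cmod t = 1 \<Longrightarrow> t * cnj t = 1"
  by (metis complex_norm_square of_real_1 one_power2)

text \<open>
  Multiplied by \<open>t\<^sup>2\<close>, the hypothesis is a polynomial identity of degree four in \<open>t\<close>; the conclusions
  are its coefficients at \<open>t\<^sup>2\<close> and \<open>t\<^sup>4\<close>.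
\<close>

lemma circle_coefficients:
  fixes A B C :: "nat \<Rightarrow> complex"
  assumes "\<And>t. cmod t = 1 \<Longrightarrow>
    (\<Sum>s<N. (cmod (t * A s + t\<^sup>2 * B s + t ^ 3 * C s))\<^sup>2) = (cmod (1 + c * t\<^sup>2))\<^sup>2"
  shows "(\<Sum>s<N. A s * cnj (A s)) + (\<Sum>s<N. B s * cnj (B s)) + (\<Sum>s<N. C s * cnj (C s)) = 1 + c * cnj c"
    and "(\<Sum>s<N. C s * cnj (A s)) = c"
proof -
  define p where "p = (\<Sum>s<N. [:A s, B s, C s:] * [:cnj (C s), cnj (B s), cnj (A s):])
     - [:1, 0, c:] * [:cnj c, 0, 1:]"
  have "poly p t = 0" if t: "cmod t = 1" for t
  proof -
    have u: "t * cnj t = 1" by (rule cnj_unit_circle[OF t])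
    have *: "poly ([:a, b, d:] * [:cnj d, cnj b, cnj a:]) t
        = t\<^sup>2 * of_real ((cmod (t * a + t\<^sup>2 * b + t ^ 3 * d))\<^sup>2)" for a b d
    proof -
      have "poly [:cnj d, cnj b, cnj a:] t = t\<^sup>2 * cnj (a + t * b + t\<^sup>2 * d)"
        using u by simp algebra
      moreover have "poly [:a, b, d:] t = a + t * b + t\<^sup>2 * d"
        by (simp add: algebra_simps power2_eq_square)
      moreover have "cmod (t * a + t\<^sup>2 * b + t ^ 3 * d) = cmod (a + t * b + t\<^sup>2 * d)"
      proof -
        have "t * a + t\<^sup>2 * b + t ^ 3 * d = t * (a + t * b + t\<^sup>2 * d)"
          by (simp add: algebra_simps power2_eq_square power3_eq_cube)
        then show ?thesis using t by (simp only: norm_mult mult_1)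
      qed
      ultimately show ?thesis
        by (simp only: poly_mult complex_norm_square mult_ac)
    qed
    have "poly ([:1, 0, c:] * [:cnj c, 0, 1:]) t = t\<^sup>2 * of_real ((cmod (1 + c * t\<^sup>2))\<^sup>2)"
    proof -
      have "poly [:cnj c, 0, 1:] t = t\<^sup>2 * cnj (1 + c * t\<^sup>2)"
        using u by simp algebra
      moreover have "poly [:1, 0, c:] t = 1 + c * t\<^sup>2"
        by (simp add: algebra_simps power2_eq_square)
      ultimately show ?thesis
        by (simp only: poly_mult complex_norm_square mult_ac)
    qed
    then show ?thesis
      using assms[OF t]
      by (simp only: p_def poly_diff poly_sum * sum_distrib_left[symmetric] of_real_sum[symmetric]) simp
  qed
  then have "p = 0" by (rule poly_zero_on_circle)
  then have "poly.coeff p 2 = 0" "poly.coeff p 4 = 0" by simp_all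
  then show "(\<Sum>s<N. A s * cnj (A s)) + (\<Sum>s<N. B s * cnj (B s)) + (\<Sum>s<N. C s * cnj (C s)) = 1 + c * cnj c"
    and "(\<Sum>s<N. C s * cnj (A s)) = c"
    by (simp_all add: p_def coeff_sum sum.distrib numeral_2_eq_2 eval_nat_numeral algebra_simps)
qed

lemma herm_self: "herm z z = of_real ((norm z)\<^sup>2)"
  by (simp add: herm_def norm_vec_def L2_set_def sum_nonneg complex_norm_square flip: of_real_power)

lemma herm_scale: "herm (a *s z) (b *s w) = a * cnj b * herm z w"
  by (simp add: herm_def sum_distrib_left mult_ac)

lemma quad_scale: "quad (a *s z) = a\<^sup>2 * quad z"
  by (simp add: quad_def sum_distrib_left power_mult_distrib)

lemma norm_scale: "norm (a *s z :: complex ^ 'n::finite) = cmod a * norm z"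
proof -
  have "norm (a *s z) = sqrt (\<Sum>j\<in>UNIV. (cmod a)\<^sup>2 * (norm (z $ j))\<^sup>2)"
    by (simp add: norm_vec_def L2_set_def norm_mult power_mult_distrib)
  also have "\<dots> = cmod a * norm z"
    by (simp add: norm_vec_def L2_set_def real_sqrt_mult flip: sum_distrib_left)
  finally show ?thesis .
qed

text \<open>
  On the unit sphere these are the coefficients along \<open>t z\<close> with \<open>\<bar>t\<bar> = 1\<close>. Both sides are homogeneous,
  of bidegree \<open>(3, 3)\<close> and \<open>(3, 1)\<close>, so the identities extend to all \<open>z\<close> by scaling.
\<close>

lemma sphere_identities:
  fixes p :: "nat \<Rightarrow> 'n::finite cpoly" and \<sigma> :: real
  assumes deg: "\<And>s. s < N \<Longrightarrow> total_degree (p s) \<le> 3"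
    and pt: "\<And>s. s < N \<Longrightarrow> eval_cpoly (p s) 0 = 0"
    and sph: "\<And>z. norm z = 1 \<Longrightarrow>
      (\<Sum>s<N. (cmod (eval_cpoly (p s) z))\<^sup>2) = (cmod (1 + of_real \<sigma> * quad z))\<^sup>2"
  shows "(\<Sum>s<N. hpart 1 (p s) z * cnj (hpart 1 (p s) z)) * herm z z ^ 2 +
           (\<Sum>s<N. hpart 2 (p s) z * cnj (hpart 2 (p s) z)) * herm z z +
           (\<Sum>s<N. hpart 3 (p s) z * cnj (hpart 3 (p s) z)) =
         herm z z ^ 3 + of_real (\<sigma>\<^sup>2) * (quad z * cnj (quad z)) * herm z z" (is ?I)
    and "(\<Sum>s<N. hpart 3 (p s) z * cnj (hpart 1 (p s) z)) = of_real \<sigma> * quad z * herm z z" (is ?II)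
proof -
  have "?I \<and> ?II"
  proof (cases "z = 0")
    case True
    have "hpart d (p s) 0 = 0" if "d > 0" for d s
      using hpart_scale[of d "p s" 0 0] that by (simp add: power_0_left)
    with True show ?thesis by (simp add: herm_def quad_def)
  next
    case False
    define r where "r = complex_of_real (norm z)"
    have r: "r \<noteq> 0" "cnj r = r" "cmod r = norm z" using False by (simp_all add: r_def)
    define u where "u = (1 / r) *s z"
    have z: "z = r *s u" using r by (simp add: u_def)
    have u: "norm u = 1" using False r(3) by (simp add: u_def norm_scale norm_divide)
    have huu: "herm u u = 1" using u by (simp add: herm_self)
    have circ: "(\<Sum>s<N. (cmod (t * hpart 1 (p s) u + t\<^sup>2 * hpart 2 (p s) u + t ^ 3 * hpart 3 (p s) u))\<^sup>2)
       = (cmod (1 + (of_real \<sigma> * quad u) * t\<^sup>2))\<^sup>2" if "cmod t = 1" for t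
    proof -
      have "norm (t *s u) = 1" using that u by (simp add: norm_scale)
      from sph[OF this] show ?thesis
        by (simp add: eval_cpoly_hparts deg pt hpart_scale quad_scale mult_ac)
    qed
    note c = circle_coefficients[where A = "\<lambda>s. hpart 1 (p s) u" and B = "\<lambda>s. hpart 2 (p s) u"
        and C = "\<lambda>s. hpart 3 (p s) u", OF circ]
    have I1: "(\<Sum>s<N. hpart d (p s) z * cnj (hpart d (p s) z))
       = (r ^ d * r ^ d) * (\<Sum>s<N. hpart d (p s) u * cnj (hpart d (p s) u))" for d
      unfolding z hpart_scale sum_distrib_left
      by (intro sum.cong refl) (simp add: r mult_ac)
    have I2: "(\<Sum>s<N. hpart 3 (p s) z * cnj (hpart 1 (p s) z))
       = r ^ 4 * (\<Sum>s<N. hpart 3 (p s) u * cnj (hpart 1 (p s) u))"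
      unfolding z hpart_scale sum_distrib_left
      by (intro sum.cong refl) (simp add: r eval_nat_numeral mult_ac)
    have hz: "herm z z = r\<^sup>2" and qz: "quad z = r\<^sup>2 * quad u"
      unfolding z by (simp_all add: herm_scale huu quad_scale r power2_eq_square)
    have ?I
    proof -
      have "r ^ 6 * ((\<Sum>s<N. hpart 1 (p s) u * cnj (hpart 1 (p s) u)) +
          (\<Sum>s<N. hpart 2 (p s) u * cnj (hpart 2 (p s) u)) +
          (\<Sum>s<N. hpart 3 (p s) u * cnj (hpart 3 (p s) u)))
        = r ^ 6 * (1 + of_real \<sigma> * quad u * cnj (of_real \<sigma> * quad u))"
        by (simp only: c(1))
      then show ?thesis
        unfolding I1 hz qz by (simp add: r algebra_simps eval_nat_numeral)
    qed
    moreover have ?II by (simp only: I2 c(2) hz qz) (simp add: algebra_simps power2_eq_square power4_eq_xxxx)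
    ultimately show ?thesis ..
  qed
  then show ?I and ?II by blast+
qed

section \<open>The trace inequality\<close>

lemma sesqui_herm: "sesqui 1 herm"
proof -
  have "sesqui (0 + 1) (\<lambda>z w. z $ j * cnj (w $ j))" for j
    by (intro sesqui_mult sesqui_component sesqui_cnj_component)
  then show ?thesis unfolding herm_def[abs_def] by (intro sesqui_sum) simp
qed

lemma sesqui_quad: "sesqui 0 (\<lambda>z w. quad z)"
  unfolding quad_def using sesqui_power[OF sesqui_component, of 2] by (intro sesqui_sum) simp

lemma sesqui_cnj_quad: "sesqui 2 (\<lambda>z w. cnj (quad w))"
  unfolding quad_def cnj_sum complex_cnj_power
  using sesqui_power[OF sesqui_cnj_component, of 2] by (intro sesqui_sum) simp

lemma sesqui_hpart_products:
  "sesqui e (\<lambda>z w. \<Sum>s\<in>A. hpart d (p s) z * cnj (hpart e (p s) w))"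
  by (intro sesqui_sum sesqui_mult'[OF sesqui_hpart sesqui_cnj_hpart]) simp

lemma polarized_identities:
  fixes p :: "nat \<Rightarrow> 'n::finite cpoly" and \<sigma> :: real
  assumes "\<And>s. s < N \<Longrightarrow> total_degree (p s) \<le> 3" "\<And>s. s < N \<Longrightarrow> eval_cpoly (p s) 0 = 0"
    "\<And>z. norm z = 1 \<Longrightarrow>
      (\<Sum>s<N. (cmod (eval_cpoly (p s) z))\<^sup>2) = (cmod (1 + of_real \<sigma> * quad z))\<^sup>2"
  shows "(\<Sum>s<N. hpart 1 (p s) z * cnj (hpart 1 (p s) w)) * herm z w ^ 2 +
           (\<Sum>s<N. hpart 2 (p s) z * cnj (hpart 2 (p s) w)) * herm z w +
           (\<Sum>s<N. hpart 3 (p s) z * cnj (hpart 3 (p s) w)) =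
         herm z w ^ 3 + of_real (\<sigma>\<^sup>2) * (quad z * cnj (quad w)) * herm z w" (is "?A z w = ?B z w")
    and "(\<Sum>s<N. hpart 3 (p s) z * cnj (hpart 1 (p s) w)) = of_real \<sigma> * quad z * herm z w"
       (is "?C z w = ?D z w")
proof -
  have h2: "sesqui 2 (\<lambda>z w :: complex ^ 'n. herm z w ^ 2)"
    and h3: "sesqui 3 (\<lambda>z w :: complex ^ 'n. herm z w ^ 3)"
    using sesqui_power[OF sesqui_herm, of 2] sesqui_power[OF sesqui_herm, of 3] by simp_all
  have "sesqui 3 (\<lambda>z w. (\<Sum>s<N. hpart 1 (p s) z * cnj (hpart 1 (p s) w)) * herm z w ^ 2)"
    by (rule sesqui_mult'[OF sesqui_hpart_products h2]) simp
  moreover have "sesqui 3 (\<lambda>z w. (\<Sum>s<N. hpart 2 (p s) z * cnj (hpart 2 (p s) w)) * herm z w)"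
    by (rule sesqui_mult'[OF sesqui_hpart_products sesqui_herm]) simp
  moreover have "sesqui 3 (\<lambda>z w. \<Sum>s<N. hpart 3 (p s) z * cnj (hpart 3 (p s) w))"
    by (rule sesqui_hpart_products)
  ultimately have "sesqui 3 ?A" by (intro sesqui_add)
  have "sesqui (0 + (0 + 2)) (\<lambda>z w :: complex ^ 'n. of_real (\<sigma>\<^sup>2) * (quad z * cnj (quad w)))"
    by (intro sesqui_mult sesqui_const sesqui_quad sesqui_cnj_quad)
  then have "sesqui 3
      (\<lambda>z w :: complex ^ 'n. of_real (\<sigma>\<^sup>2) * (quad z * cnj (quad w)) * herm z w)"
    by (rule sesqui_mult'[OF _ sesqui_herm]) simp
  with h3 have "sesqui 3 ?B" by (rule sesqui_add)
  with \<open>sesqui 3 ?A\<close> have "sesqui 3 (\<lambda>z w. ?A z w - ?B z w)" by (rule sesqui_diff)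
  then have "?A z w - ?B z w = 0"
    by (rule sesqui_polarization) (simp only: sphere_identities(1)[OF assms] diff_self)
  then show "?A z w = ?B z w" by simp
  have "sesqui 1 ?C" by (rule sesqui_hpart_products)
  moreover have "sesqui (0 + 0 + 1) ?D"
    by (intro sesqui_mult sesqui_const sesqui_quad sesqui_herm)
  ultimately have "sesqui 1 (\<lambda>z w. ?C z w - ?D z w)" by (intro sesqui_diff) simp_all
  then have "?C z w - ?D z w = 0"
    by (rule sesqui_polarization) (simp only: sphere_identities(2)[OF assms] diff_self)
  then show "?C z w = ?D z w" by simp
qed

lemma dcontr_herm_cube:
  "dcontr (\<lambda>z w :: complex ^ 'n::finite. herm z w ^ 3) = of_real ((real CARD('n) + 2) / 3 * real CARD('n))"
proof -
  have "(\<lambda>z w :: complex ^ 'n. herm z w ^ 3) =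
    (\<lambda>z w. \<Sum>s\<in>UNIV. lin (kron s) z * cnj (lin (kron s) w) * herm z w ^ 2)"
    by (simp add: lin_kron herm_def power3_eq_cube power2_eq_square sum_distrib_right mult_ac)
  moreover have "(\<Sum>s\<in>UNIV. \<Sum>j\<in>UNIV. (cmod (kron s (j::'n)))\<^sup>2) = real CARD('n)"
  proof -
    have "(cmod (kron s j))\<^sup>2 = (if s = j then 1 else 0)" for s j :: 'n
      by (simp add: kron_def)
    then show ?thesis by simp
  qed
  ultimately show ?thesis by (simp only: dcontr_linear_squares)
qed

lemma dcontr_quad:
  "dcontr (\<lambda>z w :: complex ^ 'n::finite. quad z * cnj (quad w) * herm z w) =
     of_real (((real CARD('n) + 2) / 3)\<^sup>2 * real CARD('n))"
proof -
  have "(\<lambda>z w :: complex ^ 'n. quad z * cnj (quad w) * herm z w) =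
    (\<lambda>z w. \<Sum>s\<in>UNIV. (quad z * z $ s) * cnj (quad w * w $ s))"
    by (simp add: herm_def sum_distrib_left mult_ac)
  moreover have "(\<Sum>k\<in>UNIV. \<Sum>s\<in>UNIV. (cmod ((of_nat CARD('n) + 2) / 3 * kron s (k::'n)))\<^sup>2)
      = ((real CARD('n) + 2) / 3)\<^sup>2 * real CARD('n)"
  proof -
    have "cmod ((of_nat CARD('n) + 2) / 3) = (real CARD('n) + 2) / 3"
    proof -
      have "(of_nat CARD('n) + 2) / 3 = complex_of_real ((real CARD('n) + 2) / 3)" by simp
      then show ?thesis by (simp only: norm_of_real) simp
    qed
    moreover have "(cmod (kron s k))\<^sup>2 = (if s = k then 1 else 0)" for s k :: 'n
      by (simp add: kron_def)
    ultimately show ?thesis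
      by (simp only: norm_mult power_mult_distrib sum_distrib_left[symmetric]) simp
  qed
  ultimately show ?thesis by (simp only: dcontr_squares contr_quad)
qed

text \<open>
  \<open>\<bar>f\<bar>\<^sup>2 r\<^sup>2\<close> is again a sum of squared moduli, namely of the functions \<open>f z\<^sub>i\<close>.
\<close>

lemma dcontr_mult_herm_nonneg:
  "\<exists>x\<ge>0. dcontr (\<lambda>z w. (\<Sum>s\<in>A. f s z * cnj (f s w)) * herm z w) = of_real x"
proof -
  have "(\<lambda>z w. (\<Sum>s\<in>A. f s z * cnj (f s w)) * herm z w) =
    (\<lambda>z w. \<Sum>(s, i)\<in>A \<times> UNIV. (f s z * z $ i) * cnj (f s w * w $ i))"
    unfolding herm_def sum_product sum.cartesian_product by (simp add: case_prod_unfold mult_ac)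
  also have "\<dots> = (\<lambda>z w. \<Sum>x\<in>A \<times> UNIV. (case x of (s, i) \<Rightarrow> \<lambda>z. f s z * z $ i) z *
       cnj ((case x of (s, i) \<Rightarrow> \<lambda>z. f s z * z $ i) w))"
    by (simp add: case_prod_unfold)
  finally show ?thesis
    by (intro exI[of _ "\<Sum>k\<in>UNIV. \<Sum>x\<in>A \<times> UNIV. (cmod (contr k (case x of (s, i) \<Rightarrow> \<lambda>z. f s z * z $ i)))\<^sup>2"]
        conjI sum_nonneg zero_le_power2) (simp only: dcontr_squares)
qed

text \<open>
  Apply the trace functional to the polarised norm identity. With \<open>V\<close> the contribution of the cubic
  part this gives \<open>l \<tau> + V \<le> n l + n \<sigma>\<^sup>2 l\<^sup>2\<close>, the quadratic part having been dropped. The second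
  identity fixes the inner products of the contracted cubic part with the linear one,
  and Cauchy-Schwarz yields \<open>(n \<sigma> l)\<^sup>2 \<le> V \<tau>\<close>. Eliminating \<open>V\<close> gives the product form.
\<close>

lemma trace_inequalities:
  fixes p :: "nat \<Rightarrow> 'n::finite cpoly" and \<sigma> :: real
  defines "l \<equiv> (real CARD('n) + 2) / 3"
  assumes P: "\<And>s. s < N \<Longrightarrow> total_degree (p s) \<le> 3" "\<And>s. s < N \<Longrightarrow> eval_cpoly (p s) 0 = 0"
    "\<And>z. norm z = 1 \<Longrightarrow>
      (\<Sum>s<N. (cmod (eval_cpoly (p s) z))\<^sup>2) = (cmod (1 + of_real \<sigma> * quad z))\<^sup>2"
    and a: "\<And>s z. hpart 1 (p s) z = lin (a s) z"
  defines "\<tau> \<equiv> (\<Sum>s<N. \<Sum>j\<in>UNIV. (cmod (a s j))\<^sup>2)"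
  shows "(\<tau> - real CARD('n)) * (\<tau> - real CARD('n) * (\<sigma>\<^sup>2 * l)) \<le> 0"
proof -
  let ?n = "real CARD('n)"
  define V where "V = (\<Sum>k\<in>UNIV. \<Sum>s<N. (cmod (contr k (hpart 3 (p s))))\<^sup>2)"
  have lam: "l > 0" by (simp add: l_def)
  obtain x where x: "x \<ge> 0"
    "dcontr (\<lambda>z w. (\<Sum>s<N. hpart 2 (p s) z * cnj (hpart 2 (p s) w)) * herm z w) = of_real x"
    using dcontr_mult_herm_nonneg[where A = "{..<N}" and f = "\<lambda>s. hpart 2 (p s)"] by blast
  have "dcontr (\<lambda>z w. (\<Sum>s<N. hpart 1 (p s) z * cnj (hpart 1 (p s) w)) * herm z w ^ 2 +
           (\<Sum>s<N. hpart 2 (p s) z * cnj (hpart 2 (p s) w)) * herm z w +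
           (\<Sum>s<N. hpart 3 (p s) z * cnj (hpart 3 (p s) w))) =
        dcontr (\<lambda>z w :: complex ^ 'n. herm z w ^ 3 + of_real (\<sigma>\<^sup>2) * (quad z * cnj (quad w) * herm z w))"
    by (simp only: polarized_identities(1)[OF P] mult.assoc)
  then have "complex_of_real (l * \<tau> + x + V) = of_real (l * ?n + \<sigma>\<^sup>2 * (l\<^sup>2 * ?n))"
    unfolding dcontr_add x(2)
    by (simp only: dcontr_cmult dcontr_quad dcontr_herm_cube dcontr_squares a
        sum_distrib_right dcontr_linear_squares \<tau>_def[symmetric] V_def[symmetric] l_def[symmetric]
        of_real_add of_real_mult)
  then have "l * \<tau> + x + V = l * ?n + \<sigma>\<^sup>2 * (l\<^sup>2 * ?n)" by (simp only: of_real_eq_iff)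
  with x(1) have V_le: "V \<le> l * (?n + \<sigma>\<^sup>2 * (l * ?n) - \<tau>)"
    by (simp add: algebra_simps power2_eq_square)
  \<comment> \<open>The polarised second identity at \<open>w = e\<^sub>k\<close>, contracted in \<open>z\<close>.\<close>
  have cross: "(\<Sum>s<N. contr k (hpart 3 (p s)) * cnj (a s k)) = of_real (\<sigma> * l)" for k
  proof -
    have "(\<Sum>s<N. hpart 3 (p s) z * cnj (a s k)) = of_real \<sigma> * (quad z * z $ k)" for z
      using polarized_identities(2)[OF P, of z "axis k 1"]
      unfolding a lin_axis by (simp add: herm_def axis_def if_distrib mult.assoc cong: if_cong)
    then have "contr k (\<lambda>z. \<Sum>s<N. hpart 3 (p s) z * cnj (a s k)) = contr k (\<lambda>z. of_real \<sigma> * (quad z * z $ k))"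
      by simp
    then show ?thesis
      by (simp add: contr_sum contr_cmult contr_cmult_right contr_quad l_def)
  qed
  have "?n * \<bar>\<sigma> * l\<bar> \<le> cmod (\<Sum>k\<in>(UNIV::'n set). \<Sum>s<N. contr k (hpart 3 (p s)) * cnj (a s k))"
    by (simp only: cross) (simp add: norm_mult abs_mult)
  also have "\<dots> \<le> (\<Sum>(k, s)\<in>(UNIV::'n set) \<times> {..<N}. cmod (contr k (hpart 3 (p s))) * cmod (a s k))"
    unfolding sum.cartesian_product
    by (rule order.trans[OF norm_sum]) (simp add: case_prod_unfold norm_mult)
  finally have cs1: "?n * \<bar>\<sigma> * l\<bar> \<le> \<dots>" .
  have "(\<Sum>(k, s)\<in>(UNIV::'n set) \<times> {..<N}. cmod (contr k (hpart 3 (p s))) * cmod (a s k))\<^sup>2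
     \<le> V * (\<Sum>(k, s)\<in>(UNIV::'n set) \<times> {..<N}. (cmod (a s k))\<^sup>2)"
    unfolding V_def sum.cartesian_product case_prod_unfold by (rule Cauchy_Schwarz_ineq_sum)
  also have "(\<Sum>(k, s)\<in>(UNIV::'n set) \<times> {..<N}. (cmod (a s k))\<^sup>2) = \<tau>"
    unfolding \<tau>_def sum.cartesian_product[symmetric] by (rule sum.swap)
  finally have cs2: "(\<Sum>(k, s)\<in>(UNIV::'n set) \<times> {..<N}. cmod (contr k (hpart 3 (p s))) * cmod (a s k))\<^sup>2 \<le> V * \<tau>" .
  have "V * \<tau> \<le> l * (?n + \<sigma>\<^sup>2 * (l * ?n) - \<tau>) * \<tau>"
    using V_le by (rule mult_right_mono) (simp add: \<tau>_def sum_nonneg)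
  moreover have "(?n * \<bar>\<sigma> * l\<bar>)\<^sup>2 \<le> V * \<tau>"
    using order.trans[OF power_mono[OF cs1, of 2] cs2] by simp
  ultimately have "(?n * (\<sigma> * l))\<^sup>2 \<le> l * (?n + \<sigma>\<^sup>2 * (l * ?n) - \<tau>) * \<tau>"
    by (simp add: power_mult_distrib)
  then have "l * ((\<tau> - ?n) * (\<tau> - ?n * (\<sigma>\<^sup>2 * l))) \<le> 0"
    by (simp add: algebra_simps power2_eq_square)
  then show ?thesis using lam by (simp add: mult_le_0_iff)
qed

section \<open>Isotropic vectors\<close>

lemma le_all_small_imp_nonpos:
  fixes e K :: real
  assumes "\<And>h. 0 < h \<Longrightarrow> h < 1 \<Longrightarrow> e \<le> K * h"
  shows "e \<le> 0"
proof (rule ccontr)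
  assume "\<not> e \<le> 0"
  then have e: "e > 0" by simp
  define h where "h = min (1/2) (e / (2 * (\<bar>K\<bar> + 1)))"
  have h: "0 < h" "h < 1" using e by (auto simp: h_def min_less_iff_disj)
  have "K * h \<le> \<bar>K\<bar> * (e / (2 * (\<bar>K\<bar> + 1)))"
    using h by (intro mult_mono) (auto simp: h_def)
  also have "\<dots> < e" using e by (simp add: field_simps) (smt (verit) mult_nonneg_nonneg)
  finally show False using assms[OF h] by simp
qed

text \<open>
  The matrix with diagonal \<open>b\<close>, \<open>d\<close> and off-diagonal entry \<open>c\<close> is bounded by the identity on the
  isotropic lines spanned by \<open>(1, \<i>)\<close> and \<open>(1, -\<i>)\<close>, and by trace \<open>2\<close> equality holds there. The
  error term is of second order near these lines, so the first-order variation of the left-hand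
  side must vanish in every direction: varying the modulus of one coordinate gives \<open>b = d\<close>, varying
  its argument gives \<open>Re c = 0\<close>, and \<open>Im c = 0\<close> comes from the two lines themselves.
\<close>

lemma isotropic_rigidity:
  fixes b d K :: real and c :: complex
  assumes K: "K \<ge> 0" and sum: "b + d = 2"
    and le: "\<And>x y :: complex. ((cmod x)\<^sup>2 * b + (cmod y)\<^sup>2 * d + 2 * Re (x * cnj y * c)) *
      ((cmod x)\<^sup>2 + (cmod y)\<^sup>2) \<le> ((cmod x)\<^sup>2 + (cmod y)\<^sup>2)\<^sup>2 + K * (cmod (x\<^sup>2 + y\<^sup>2))\<^sup>2"
  shows "b = 1" "d = 1" "c = 0"
proof -
  have im: "Im c = 0"
    using le[of 1 \<i>] le[of 1 "-\<i>"] sum by (simp add: power2_eq_square)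
  have 1: "b' \<le> 1" if b': "b' + d' = 2"
    and le': "\<And>u. 0 < u \<Longrightarrow> u < 1 \<Longrightarrow> (b' + u * d') * (1 + u) \<le> (1 + u)\<^sup>2 + K * (1 - u)\<^sup>2" for b' d'
  proof -
    have "b' - 1 \<le> K * h" if h: "0 < h" "h < 1" for h
    proof (cases "b' \<le> 1")
      case False
      have "(b' + (1 - h) * d') * (2 - h) \<le> (2 - h)\<^sup>2 + K * h\<^sup>2"
        using le'[of "1 - h"] h by simp
      moreover have "d' = 2 - b'" using b' by simp
      ultimately have "h * ((b' - 1) * (2 - h)) \<le> h * (K * h)"
        by (simp add: algebra_simps power2_eq_square)
      then have "(b' - 1) * (2 - h) \<le> K * h" using h by simp
      moreover have "(b' - 1) * 1 \<le> (b' - 1) * (2 - h)"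
        using False h by (intro mult_left_mono) auto
      ultimately show ?thesis by simp
    qed (use K h in \<open>smt (verit) mult_nonneg_nonneg\<close>)
    from le_all_small_imp_nonpos[OF this] show ?thesis by simp
  qed
  have "b \<le> 1"
  proof (rule 1[OF sum])
    fix u :: real assume u: "0 < u" "u < 1"
    have "(cmod (1 + (\<i> * complex_of_real (sqrt u))\<^sup>2))\<^sup>2 = (1 - u)\<^sup>2"
    proof -
      have "1 + (\<i> * complex_of_real (sqrt u))\<^sup>2 = complex_of_real (1 - u)"
        using u by (simp add: power_mult_distrib flip: of_real_power)
      then show ?thesis by (simp only: norm_of_real) simp
    qed
    then show "(b + u * d) * (1 + u) \<le> (1 + u)\<^sup>2 + K * (1 - u)\<^sup>2"
      using le[of 1 "\<i> * of_real (sqrt u)"] u im by (simp add: norm_mult)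
  qed
  moreover have "d \<le> 1"
  proof (rule 1[of d b])
    fix u :: real assume u: "0 < u" "u < 1"
    have "(cmod ((\<i> * complex_of_real (sqrt u))\<^sup>2 + 1))\<^sup>2 = (1 - u)\<^sup>2"
    proof -
      have "(\<i> * complex_of_real (sqrt u))\<^sup>2 + 1 = complex_of_real (1 - u)"
        using u by (simp add: power_mult_distrib flip: of_real_power)
      then show ?thesis by (simp only: norm_of_real) simp
    qed
    then show "(d + u * b) * (1 + u) \<le> (1 + u)\<^sup>2 + K * (1 - u)\<^sup>2"
      using le[of "\<i> * of_real (sqrt u)" 1] u im by (simp add: norm_mult add.commute)
  qed (use sum in simp)
  ultimately show b: "b = 1" and d: "d = 1" using sum by simp_all
  have 2: "r \<le> 0" if r: "r = Re c \<or> r = - Re c" for r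
  proof (rule le_all_small_imp_nonpos)
    fix h :: real assume h: "0 < h" "h < 1"
    define s :: real where "s = (if r = Re c then 1 else -1)"
    have s: "s\<^sup>2 = 1" "s * Re c = r" using r by (auto simp: s_def)
    define y where "y = Complex (s * h) 1"
    have n: "(cmod y)\<^sup>2 = 1 + h\<^sup>2" 
      by (simp add: y_def cmod_power2 power_mult_distrib s)
    have q: "(cmod (1 + y\<^sup>2))\<^sup>2 = h ^ 4 + 4 * h\<^sup>2"
    proof -
      have "1 + y\<^sup>2 = Complex (h\<^sup>2) (2 * s * h)"
        using s(1) by (simp add: y_def complex_eq_iff power2_eq_square algebra_simps)
      then show ?thesis using s(1) by (simp add: cmod_power2 power_mult_distrib)
    qed
    have "Re (cnj y * c) = h * r" using im s(2) by (simp add: y_def algebra_simps)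
    then have "(1 + (1 + h\<^sup>2) + 2 * (h * r)) * (2 + h\<^sup>2) \<le> (2 + h\<^sup>2)\<^sup>2 + K * (h ^ 4 + 4 * h\<^sup>2)"
      using le[of 1 y] by (simp add: n q b d)
    then have "(2 * h) * (r * (2 + h\<^sup>2)) \<le> (2 * h) * (K * h * (h\<^sup>2 + 4) / 2)"
      by (simp add: algebra_simps power2_eq_square eval_nat_numeral)
    then have "r * (2 + h\<^sup>2) \<le> K * h * (h\<^sup>2 + 4) / 2"
      using h by (subst (asm) mult_le_cancel_left_pos) auto
    also have "\<dots> \<le> (K * h) * (2 + h\<^sup>2)"
    proof -
      have "0 \<le> K * h * h\<^sup>2" using K h by simp
      then show ?thesis by (simp add: algebra_simps)
    qed
    finally show "r \<le> K * h"
      by (rule mult_right_le_imp_le) (use h in \<open>simp add: add_pos_nonneg\<close>)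
  qed
  from 2[of "Re c"] 2[of "- Re c"] im show "c = 0" by (simp add: complex_eq_iff)
qed

lemma sum_pairs:
  fixes f :: "'n::finite \<Rightarrow> real"
  shows "(\<Sum>(j, k) | j \<noteq> k. f j + f k) = 2 * (real CARD('n) - 1) * (\<Sum>j\<in>UNIV. f j)"
proof -
  have "(\<Sum>(j, k) | j \<noteq> k. f j + f k) + (\<Sum>(j, k) | j = k. f j + f k) = (\<Sum>(j, k)\<in>UNIV. f j + f k)"
    by (subst sum.union_disjoint[symmetric]) (auto intro!: sum.cong)
  moreover have "(\<Sum>(j, k)\<in>UNIV. f j + f k) = (\<Sum>j\<in>UNIV. \<Sum>k\<in>UNIV. f j + f k)"
    by (simp add: sum.cartesian_product)
  moreover have "(\<Sum>(j, k) | j = k. f j + f k) = (\<Sum>j\<in>UNIV. f j + f j)"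
    by (rule sum.reindex_bij_witness[of _ "\<lambda>j. (j, j)" fst]) auto
  ultimately show ?thesis
    by (simp add: sum.distrib algebra_simps flip: sum_distrib_left sum_distrib_right)
qed

text \<open>
  Each pair of coordinates contributes at most \<open>2\<close> by the value at \<open>e\<^sub>j \<plusminus> \<i> e\<^sub>k\<close>. Averaging over all
  pairs bounds the trace, and in the case of equality every pair is extremal, hence rigid.
\<close>

lemma trace_bound:
  fixes B :: "'n::finite \<Rightarrow> 'n \<Rightarrow> complex" and \<beta> :: "'n \<Rightarrow> real"
  assumes K: "K \<ge> 0" and n: "CARD('n) \<ge> 2"
    and le: "\<And>j k x y. j \<noteq> k \<Longrightarrow>
      ((cmod x)\<^sup>2 * \<beta> j + (cmod y)\<^sup>2 * \<beta> k + 2 * Re (x * cnj y * B j k)) *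
      ((cmod x)\<^sup>2 + (cmod y)\<^sup>2) \<le> ((cmod x)\<^sup>2 + (cmod y)\<^sup>2)\<^sup>2 + K * (cmod (x\<^sup>2 + y\<^sup>2))\<^sup>2"
  shows "(\<Sum>j\<in>UNIV. \<beta> j) \<le> real CARD('n)"
    and "(\<Sum>j\<in>UNIV. \<beta> j) = real CARD('n) \<Longrightarrow> \<beta> j = 1"
    and "(\<Sum>j\<in>UNIV. \<beta> j) = real CARD('n) \<Longrightarrow> j \<noteq> k \<Longrightarrow> B j k = 0"
proof -
  let ?d = "\<lambda>j. 1 - \<beta> j"
  have pair: "\<beta> j + \<beta> k \<le> 2" if "j \<noteq> k" for j k
    using le[OF that, of 1 \<i>] le[OF that, of 1 "-\<i>"] by simp
  have nonneg: "0 \<le> (case p of (j, k) \<Rightarrow> ?d j + ?d k)" if "p \<in> {(j, k). j \<noteq> k}" for p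
    using pair that by (auto simp: algebra_simps)
  have S: "(\<Sum>(j, k) | j \<noteq> k. ?d j + ?d k) = 2 * (real CARD('n) - 1) * (real CARD('n) - (\<Sum>j\<in>UNIV. \<beta> j))"
    by (simp only: sum_pairs sum_subtractf) simp
  have "0 \<le> (\<Sum>(j, k) | j \<noteq> k. ?d j + ?d k)"
    by (intro sum_nonneg nonneg)
  then show "(\<Sum>j\<in>UNIV. \<beta> j) \<le> real CARD('n)"
    unfolding S using n by (simp add: zero_le_mult_iff)
  assume eq: "(\<Sum>j\<in>UNIV. \<beta> j) = real CARD('n)"
  have sum2: "\<beta> j + \<beta> k = 2" if "j \<noteq> k" for j k
  proof -
    have "(\<Sum>(j, k) | j \<noteq> k. ?d j + ?d k) = 0" using S eq by simp
    then have "\<forall>p\<in>{(j, k). j \<noteq> k}. (case p of (j, k) \<Rightarrow> ?d j + ?d k) = 0"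
      by (subst (asm) sum_nonneg_eq_0_iff) (use nonneg in auto)
    with that show ?thesis by force
  qed
  show "\<beta> j = 1"
  proof -
    have "\<exists>k. j \<noteq> k"
    proof -
      have "UNIV \<noteq> {j}"
      proof
        assume "UNIV = {j}"
        then have "CARD('n) = card {j}" by (rule arg_cong)
        with n show False by simp
      qed
      then show ?thesis by (auto simp: set_eq_iff)
    qed
    then obtain k where jk: "j \<noteq> k" by blast
    from isotropic_rigidity(1)[OF K sum2[OF jk] le[OF jk]] show ?thesis .
  qed
  show "B j k = 0" if "j \<noteq> k"
    by (rule isotropic_rigidity(3)[OF K sum2[OF that] le[OF that]])
qed

section \<open>Necessity of the bound\<close>

text \<open>
  Reducedness enters only through the exclusion of \<open>P = g P\<^sub>1\<close>, which is what equality in the trace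
  bound would force: with \<open>\<parallel>P\<^sub>1\<parallel>\<^sup>2 = r\<^sup>2\<close> the two identities combine to
  \<open>\<parallel>P\<^sub>3 - \<sigma> q P\<^sub>1\<parallel>\<^sup>2 + \<parallel>P\<^sub>2\<parallel>\<^sup>2 r\<^sup>2 = 0\<close>.
\<close>

lemma sphere_map_imp_bound:
  fixes p :: "nat \<Rightarrow> 'n::finite cpoly" and g :: "'n cpoly" and \<sigma> :: real
  assumes n: "CARD('n) \<ge> 2" and \<sigma>: "\<sigma> > 0"
    and g: "\<And>z. eval_cpoly g z = 1 + of_real \<sigma> * quad z"
    and red: "\<not> (\<forall>s<N. g dvd p s)"
    and deg: "\<And>s. s < N \<Longrightarrow> total_degree (p s) \<le> 3"
    and pt: "\<And>s. s < N \<Longrightarrow> eval_cpoly (p s) 0 = 0"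
    and sph: "\<And>z. norm z = 1 \<Longrightarrow>
      (\<Sum>s<N. (cmod (eval_cpoly (p s) z))\<^sup>2) = (cmod (eval_cpoly g z))\<^sup>2"
  shows "\<sigma>\<^sup>2 * ((real CARD('n) + 2) / 3) < 1"
proof -
  let ?n = "real CARD('n)" and ?l = "(real CARD('n) + 2) / 3"
  note P = deg pt sph[unfolded g]
  define P1 P2 P3 where "P1 = (\<lambda>s. hpart 1 (p s))" and "P2 = (\<lambda>s. hpart 2 (p s))"
    and "P3 = (\<lambda>s. hpart 3 (p s))"
  have "\<exists>a. \<forall>z. P1 s z = lin a z" for s
    unfolding P1_def lin_def by (rule hpart_1[of "p s"]) blast
  then obtain a where a: "\<And>s z. P1 s z = lin (a s) z" by metis
  define \<tau> where "\<tau> = (\<Sum>s<N. \<Sum>j\<in>UNIV. (cmod (a s j))\<^sup>2)"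
  define B where "B j k = (\<Sum>s<N. a s j * cnj (a s k))" for j k
  define \<beta> where "\<beta> j = (\<Sum>s<N. (cmod (a s j))\<^sup>2)" for j
  have tau_sum: "(\<Sum>j\<in>UNIV. \<beta> j) = \<tau>" unfolding \<beta>_def \<tau>_def by (rule sum.swap)
  have sq: "(\<Sum>s<N. f s * cnj (f s)) = of_real (\<Sum>s<N. (cmod (f s))\<^sup>2)" for f :: "nat \<Rightarrow> complex"
    by (simp only: of_real_sum complex_norm_square)
  have I: "(\<Sum>s<N. (cmod (P1 s z))\<^sup>2) * ((norm z)\<^sup>2)\<^sup>2 + (\<Sum>s<N. (cmod (P2 s z))\<^sup>2) * (norm z)\<^sup>2
      + (\<Sum>s<N. (cmod (P3 s z))\<^sup>2) = ((norm z)\<^sup>2) ^ 3 + \<sigma>\<^sup>2 * (cmod (quad z))\<^sup>2 * (norm z)\<^sup>2" for z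
  proof -
    have "quad z * cnj (quad z) = of_real ((cmod (quad z))\<^sup>2)" by (rule complex_norm_square[symmetric])
    then have "complex_of_real ((\<Sum>s<N. (cmod (P1 s z))\<^sup>2) * ((norm z)\<^sup>2)\<^sup>2 + (\<Sum>s<N. (cmod (P2 s z))\<^sup>2) * (norm z)\<^sup>2
      + (\<Sum>s<N. (cmod (P3 s z))\<^sup>2)) = of_real (((norm z)\<^sup>2) ^ 3 + \<sigma>\<^sup>2 * (cmod (quad z))\<^sup>2 * (norm z)\<^sup>2)"
      using sphere_identities(1)[OF P, where z = z]
      by (simp only: sq herm_self P1_def P2_def P3_def of_real_add of_real_mult of_real_power)
    then show ?thesis by (simp only: of_real_eq_iff)
  qed
  \<comment> \<open>The norm identity on the plane of \<open>e\<^sub>j\<close> and \<open>e\<^sub>k\<close>, divided by \<open>r\<^sup>2\<close>, without the quadratic and cubic parts.\<close>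
  have le: "((cmod x)\<^sup>2 * \<beta> j + (cmod y)\<^sup>2 * \<beta> k + 2 * Re (x * cnj y * B j k)) *
      ((cmod x)\<^sup>2 + (cmod y)\<^sup>2) \<le> ((cmod x)\<^sup>2 + (cmod y)\<^sup>2)\<^sup>2 + \<sigma>\<^sup>2 * (cmod (x\<^sup>2 + y\<^sup>2))\<^sup>2"
    (is "?b * ?R \<le> _") if jk: "j \<noteq> k" for j k x y
  proof (cases "?R = 0")
    case True
    then show ?thesis using \<sigma> by simp
  next
    case False
    then have R: "?R > 0" by (smt (verit) zero_le_power2)
    define z where "z = x *s axis j 1 + y *s axis k (1::complex)"
    have zi: "z $ i = (if i = j then x else if i = k then y else 0)" for i
      using jk by (simp add: z_def axis_def)
    have split: "(\<Sum>i\<in>UNIV. f (z $ i)) = f x + f y" if "f 0 = 0" for f :: "complex \<Rightarrow> 'a::comm_monoid_add"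
    proof -
      have "(\<Sum>i\<in>UNIV. f (z $ i)) = (\<Sum>i\<in>{j, k}. f (z $ i))"
        by (rule sum.mono_neutral_right) (use that in \<open>auto simp: zi\<close>)
      then show ?thesis using jk by (simp add: zi)
    qed
    have nz: "(norm z)\<^sup>2 = ?R"
      using split[of "\<lambda>c. (cmod c)\<^sup>2"] by (simp add: norm_vec_def L2_set_def sum_nonneg)
    have qz: "quad z = x\<^sup>2 + y\<^sup>2" using split[of "\<lambda>c. c\<^sup>2"] by (simp add: quad_def)
    have "(cmod (P1 s z))\<^sup>2 = (cmod x)\<^sup>2 * (cmod (a s j))\<^sup>2 + (cmod y)\<^sup>2 * (cmod (a s k))\<^sup>2
       + 2 * Re (x * cnj y * (a s j * cnj (a s k)))" for s
    proof -
      have "P1 s z = x * a s j + y * a s k"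
      proof -
        have "lin (a s) (c *s v) = c * lin (a s) v" for c v
          by (simp add: lin_def sum_distrib_left mult_ac)
        then show ?thesis by (simp add: a z_def lin_add lin_axis)
      qed
      then show ?thesis
        by (simp only: cmod_power2) (simp add: algebra_simps power2_eq_square)
    qed
    then have "(\<Sum>s<N. (cmod (P1 s z))\<^sup>2) = ?b"
      by (simp add: \<beta>_def B_def sum.distrib sum_distrib_left)
    moreover have "0 \<le> (\<Sum>s<N. (cmod (P2 s z))\<^sup>2) * ?R" "0 \<le> (\<Sum>s<N. (cmod (P3 s z))\<^sup>2)"
      using R by (simp_all add: sum_nonneg)
    ultimately have "?R * (?b * ?R) \<le> ?R * (?R\<^sup>2 + \<sigma>\<^sup>2 * (cmod (x\<^sup>2 + y\<^sup>2))\<^sup>2)"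
      using I[of z] by (simp only: nz qz) (simp add: algebra_simps power2_eq_square power3_eq_cube)
    then show ?thesis using R by (subst (asm) mult_le_cancel_left_pos) auto
  qed
  note tb = trace_bound[where \<beta> = \<beta> and B = B and K = "\<sigma>\<^sup>2", OF _ n le, unfolded tau_sum]
  have "\<tau> \<noteq> ?n"
  proof
    assume eq: "\<tau> = ?n"
    have b: "B j k = (if j = k then 1 else 0)" for j k
    proof (cases "j = k")
      case True
      have "B j j = of_real (\<beta> j)" unfolding B_def \<beta>_def by (rule sq)
      with True tb(2)[OF _ _ eq] show ?thesis by simp
    qed (use tb(3)[OF _ _ eq] in simp)
    have N1: "(\<Sum>s<N. P1 s z * cnj (P1 s z)) = herm z z" for z
    proof -
      have "(\<Sum>s<N. P1 s z * cnj (P1 s z)) = (\<Sum>s<N. \<Sum>j\<in>UNIV. \<Sum>k\<in>UNIV. z $ j * cnj (z $ k) * (a s j * cnj (a s k)))"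
        by (simp add: a lin_def sum_product mult_ac)
      also have "\<dots> = (\<Sum>j\<in>UNIV. \<Sum>k\<in>UNIV. z $ j * cnj (z $ k) * B j k)"
        by (subst sum.swap, intro sum.cong refl, subst sum.swap) (simp add: B_def sum_distrib_left)
      also have "\<dots> = herm z z"
        by (simp add: b herm_def if_distrib cong: if_cong)
      finally show ?thesis .
    qed
    have zero: "P2 s z = 0 \<and> P3 s z = of_real \<sigma> * quad z * P1 s z" if s: "s < N" for s z
    proof (cases "z = 0")
      case True
      have "hpart d (p s) 0 = 0" if "d > 0" for d
        using hpart_scale[of d "p s" 0 0] that by (simp add: power_0_left)
      with True show ?thesis by (simp add: P1_def P2_def P3_def)
    next
      case False
      let ?r = "(norm z)\<^sup>2" and ?c = "of_real \<sigma> * quad z"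
      have II: "(\<Sum>s<N. P3 s z * cnj (P1 s z)) = ?c * herm z z"
        unfolding P1_def P3_def by (rule sphere_identities(2)[OF P])
      have II': "(\<Sum>s<N. P1 s z * cnj (P3 s z)) = cnj ?c * herm z z"
        using arg_cong[OF II, of cnj] by (simp add: mult.commute herm_self)
      have "(\<Sum>s<N. (P3 s z - ?c * P1 s z) * cnj (P3 s z - ?c * P1 s z)) =
          (\<Sum>s<N. P3 s z * cnj (P3 s z)) - cnj ?c * (\<Sum>s<N. P3 s z * cnj (P1 s z))
          - ?c * (\<Sum>s<N. P1 s z * cnj (P3 s z)) + ?c * cnj ?c * (\<Sum>s<N. P1 s z * cnj (P1 s z))"
        by (simp add: sum_distrib_left sum.distrib sum_subtractf algebra_simps)
      also have "\<dots> = (\<Sum>s<N. P3 s z * cnj (P3 s z)) - ?c * cnj ?c * herm z z"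
        by (simp only: II II' N1) (simp add: algebra_simps)
      finally have "complex_of_real (\<Sum>s<N. (cmod (P3 s z - ?c * P1 s z))\<^sup>2) =
          of_real ((\<Sum>s<N. (cmod (P3 s z))\<^sup>2) - (cmod ?c)\<^sup>2 * ?r)"
        by (simp only: sq herm_self of_real_diff of_real_mult complex_norm_square)
      then have 1: "(\<Sum>s<N. (cmod (P3 s z - ?c * P1 s z))\<^sup>2) =
          (\<Sum>s<N. (cmod (P3 s z))\<^sup>2) - \<sigma>\<^sup>2 * (cmod (quad z))\<^sup>2 * ?r"
        by (simp only: of_real_eq_iff) (simp add: norm_mult power_mult_distrib)
      have "complex_of_real (\<Sum>s<N. (cmod (P1 s z))\<^sup>2) = of_real ?r"
        using N1[of z] by (simp only: sq herm_self)
      then have "(\<Sum>s<N. (cmod (P1 s z))\<^sup>2) = ?r" by (simp only: of_real_eq_iff)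
      with I[of z] 1 have 2: "(\<Sum>s<N. (cmod (P3 s z - ?c * P1 s z))\<^sup>2) + (\<Sum>s<N. (cmod (P2 s z))\<^sup>2) * ?r = 0"
        by (simp add: power2_eq_square power3_eq_cube)
      have r: "?r > 0" using False by simp
      have nn: "0 \<le> (\<Sum>s<N. (cmod (P3 s z - ?c * P1 s z))\<^sup>2)" "0 \<le> (\<Sum>s<N. (cmod (P2 s z))\<^sup>2)"
        by (simp_all add: sum_nonneg)
      then have "(\<Sum>s<N. (cmod (P3 s z - ?c * P1 s z))\<^sup>2) = 0" "(\<Sum>s<N. (cmod (P2 s z))\<^sup>2) = 0"
        using 2 r by (smt (verit) mult_nonneg_nonneg mult_pos_pos)+
      then show ?thesis using s by (simp add: sum_nonneg_eq_0_iff)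
    qed
    have "g dvd p s" if s: "s < N" for s
    proof -
      have "p s = g * (\<Sum>j\<in>UNIV. Cst (a s j) * Var j)"
      proof (rule eval_cpoly_inject)
        fix z
        have "eval_cpoly (p s) z = P1 s z + P2 s z + P3 s z"
          unfolding P1_def P2_def P3_def by (rule eval_cpoly_hparts[OF deg[OF s] pt[OF s]])
        also have "\<dots> = eval_cpoly g z * P1 s z"
          using zero[OF s] by (simp add: g algebra_simps)
        finally show "eval_cpoly (p s) z = eval_cpoly (g * (\<Sum>j\<in>UNIV. Cst (a s j) * Var j)) z"
          by (simp add: a lin_def)
      qed
      then show ?thesis by simp
    qed
    with red show False by blast
  qed
  with tb(1) have lt: "\<tau> < ?n" by simp
  have "(\<tau> - ?n) * (\<tau> - ?n * (\<sigma>\<^sup>2 * ?l)) \<le> 0"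
    unfolding \<tau>_def using trace_inequalities[OF P, where a = a] a by (simp add: P1_def)
  with lt have "?n * (\<sigma>\<^sup>2 * ?l) \<le> \<tau>"
    by (auto simp: mult_le_0_iff)
  from le_less_trans[OF this lt] have "?n * (\<sigma>\<^sup>2 * ?l) < ?n * 1" by (simp only: mult_1_right)
  then show ?thesis by (subst (asm) mult_less_cancel_left_pos) auto
qed

section \<open>Holomorphy of quotients of polynomials\<close>

lemma holomorphic_mv_const: "holomorphic_mv_on (\<lambda>z. c) S"
  unfolding holomorphic_mv_on_def by (auto intro!: exI[of _ "\<lambda>v. 0"])

lemma holomorphic_mv_component: "holomorphic_mv_on (\<lambda>z. z $ j) S"
  unfolding holomorphic_mv_on_def
  by (auto intro!: exI[of _ "\<lambda>v. v $ j"] bounded_linear.has_derivative[OF bounded_linear_vec_nth]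
      has_derivative_ident)

lemma holomorphic_mv_add:
  assumes "holomorphic_mv_on f S" "holomorphic_mv_on g S"
  shows "holomorphic_mv_on (\<lambda>z. f z + g z) S"
  unfolding holomorphic_mv_on_def
proof
  fix z assume "z \<in> S"
  then obtain f' g' where "(f has_derivative f') (at z within S)" "(g has_derivative g') (at z within S)"
    "\<forall>c v. f' (c *s v) = c * f' v" "\<forall>c v. g' (c *s v) = c * g' v"
    using assms unfolding holomorphic_mv_on_def by blast
  then show "\<exists>h. ((\<lambda>z. f z + g z) has_derivative h) (at z within S) \<and> (\<forall>c v. h (c *s v) = c * h v)"
    by (intro exI[of _ "\<lambda>v. f' v + g' v"]) (auto intro: has_derivative_add simp: algebra_simps)
qed

lemma holomorphic_mv_mult:
  assumes "holomorphic_mv_on f S" "holomorphic_mv_on g S"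
  shows "holomorphic_mv_on (\<lambda>z. f z * g z) S"
  unfolding holomorphic_mv_on_def
proof
  fix z assume "z \<in> S"
  then obtain f' g' where "(f has_derivative f') (at z within S)" "(g has_derivative g') (at z within S)"
    "\<forall>c v. f' (c *s v) = c * f' v" "\<forall>c v. g' (c *s v) = c * g' v"
    using assms unfolding holomorphic_mv_on_def by blast
  then show "\<exists>h. ((\<lambda>z. f z * g z) has_derivative h) (at z within S) \<and> (\<forall>c v. h (c *s v) = c * h v)"
    by (intro exI[of _ "\<lambda>v. f z * g' v + f' v * g z"]) (auto intro: has_derivative_mult simp: algebra_simps)
qed

lemma holomorphic_mv_divide:
  assumes "holomorphic_mv_on f S" "holomorphic_mv_on g S" "\<And>z. z \<in> S \<Longrightarrow> g z \<noteq> 0"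
  shows "holomorphic_mv_on (\<lambda>z. f z / g z) S"
  unfolding holomorphic_mv_on_def
proof
  fix z assume z: "z \<in> S"
  then obtain f' g' where "(f has_derivative f') (at z within S)" "(g has_derivative g') (at z within S)"
    "\<forall>c v. f' (c *s v) = c * f' v" "\<forall>c v. g' (c *s v) = c * g' v"
    using assms(1,2) unfolding holomorphic_mv_on_def by blast
  then show "\<exists>h. ((\<lambda>z. f z / g z) has_derivative h) (at z within S) \<and> (\<forall>c v. h (c *s v) = c * h v)"
    using assms(3)[OF z]
    by (intro exI[of _ "\<lambda>v. (f' v * g z - f z * g' v) / (g z * g z)"])
       (auto intro: has_derivative_divide' simp: algebra_simps)
qed

lemma holomorphic_mv_sum:
  "(\<And>i. i \<in> A \<Longrightarrow> holomorphic_mv_on (f i) S) \<Longrightarrow> holomorphic_mv_on (\<lambda>z. \<Sum>i\<in>A. f i z) S"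
  by (induction A rule: infinite_finite_induct) (auto intro: holomorphic_mv_const holomorphic_mv_add)

lemma holomorphic_mv_prod:
  "(\<And>i. i \<in> A \<Longrightarrow> holomorphic_mv_on (f i) S) \<Longrightarrow> holomorphic_mv_on (\<lambda>z. \<Prod>i\<in>A. f i z) S"
  by (induction A rule: infinite_finite_induct) (auto intro: holomorphic_mv_const holomorphic_mv_mult)

lemma holomorphic_mv_power:
  "holomorphic_mv_on f S \<Longrightarrow> holomorphic_mv_on (\<lambda>z. f z ^ k) S"
  by (induction k) (auto intro: holomorphic_mv_const holomorphic_mv_mult)

lemma holomorphic_mv_eval_cpoly: "holomorphic_mv_on (eval_cpoly p) S"
  unfolding eval_cpoly_def[abs_def]
  by (intro holomorphic_mv_sum holomorphic_mv_mult holomorphic_mv_const holomorphic_mv_prod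
      holomorphic_mv_power holomorphic_mv_component)

lemma holomorphic_quotientI:
  assumes "\<And>z. z \<in> ball 0 1 \<Longrightarrow> eval_cpoly g z \<noteq> 0"
  shows "holomorphic_quotient_on_ball N p g"
  unfolding holomorphic_quotient_on_ball_def
proof (intro conjI allI impI)
  show "g \<noteq> 0" using assms[of 0] by auto
  show "\<exists>f. holomorphic_mv_on f (ball 0 1) \<and>
       (\<forall>z\<in>ball 0 1. eval_cpoly g z \<noteq> 0 \<longrightarrow> f z = eval_cpoly (p i) z / eval_cpoly g z)" for i
    by (rule exI[of _ "\<lambda>z. eval_cpoly (p i) z / eval_cpoly g z"])
       (use assms in \<open>auto intro!: holomorphic_mv_divide holomorphic_mv_eval_cpoly\<close>)
qed

section \<open>Sums of squares of harmonic cubics\<close>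

lemma norm_quad_le: "cmod (quad z) \<le> (norm z)\<^sup>2"
proof -
  have "cmod (quad z) \<le> (\<Sum>j\<in>UNIV. (cmod (z $ j))\<^sup>2)"
    unfolding quad_def by (rule order.trans[OF norm_sum]) (simp add: norm_power)
  then show ?thesis by (simp add: norm_vec_def L2_set_def sum_nonneg)
qed

lemma norm_sq_sum: "(norm (z :: complex ^ 'n::finite))\<^sup>2 = (\<Sum>j\<in>UNIV. (cmod (z $ j))\<^sup>2)"
  by (simp add: norm_vec_def L2_set_def sum_nonneg)

text \<open>
  The cubics on the left are the orthogonal projections of the monomials \<open>z\<^sub>i z\<^sub>j z\<^sub>k\<close> onto the harmonic
  cubics, so the right-hand side is \<open>r\<^sup>6\<close> minus its part in the span of the \<open>q z\<^sub>i\<close>.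
\<close>

lemma harmonic_cubes_norm:
  fixes z :: "complex ^ 'n::finite"
  defines "D \<equiv> \<lambda>i j k. kron i j * z $ k + kron i k * z $ j + kron j k * z $ i"
  shows "(\<Sum>i\<in>UNIV. \<Sum>j\<in>UNIV. \<Sum>k\<in>UNIV.
      (cmod (z $ i * z $ j * z $ k - quad z / (of_nat CARD('n) + 2) * D i j k))\<^sup>2)
    = ((norm z)\<^sup>2) ^ 3 - 3 / (real CARD('n) + 2) * (cmod (quad z))\<^sup>2 * (norm z)\<^sup>2"
proof -
  let ?S = "\<lambda>f. \<Sum>i\<in>UNIV. \<Sum>j\<in>UNIV. \<Sum>k\<in>UNIV. f i j (k :: 'n)"
  let ?n = "real CARD('n) + 2"
  let ?A = "\<lambda>i j k. z $ i * z $ j * z $ k"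
  define c where "c = quad z / of_real ?n"
  have n: "?n > 0" by simp
  have c': "quad z / (of_nat CARD('n) + 2) = c" by (simp add: c_def)
  have AA: "?S (\<lambda>i j k. (cmod (?A i j k))\<^sup>2) = ((norm z)\<^sup>2) ^ 3"
    by (simp add: norm_sq_sum norm_mult power_mult_distrib power3_eq_cube sum_product
        sum_distrib_left sum_distrib_right mult_ac)
  have AD: "?S (\<lambda>i j k. ?A i j k * cnj (D i j k)) = 3 * quad z * of_real ((norm z)\<^sup>2)"
  proof -
    have "?A i j k * cnj (D i j k) =
       kron i j * (z $ i * z $ j * (z $ k * cnj (z $ k))) + kron i k * (z $ i * z $ k * (z $ j * cnj (z $ j)))
       + kron j k * (z $ j * z $ k * (z $ i * cnj (z $ i)))" for i j k
      by (simp add: D_def algebra_simps)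
    then have "?S (\<lambda>i j k. ?A i j k * cnj (D i j k)) =
        (\<Sum>i\<in>UNIV. \<Sum>k\<in>UNIV. z $ i * z $ i * (z $ k * cnj (z $ k)))
        + (\<Sum>i\<in>UNIV. \<Sum>j\<in>UNIV. z $ i * z $ i * (z $ j * cnj (z $ j)))
        + (\<Sum>i\<in>UNIV. \<Sum>j\<in>UNIV. z $ j * z $ j * (z $ i * cnj (z $ i)))"
      by (simp only: sum.distrib sum_distrib_left[symmetric] kron_sum)
    also have "\<dots> = 3 * (\<Sum>i\<in>UNIV. \<Sum>j\<in>UNIV. z $ i * z $ i * (z $ j * cnj (z $ j)))"
      by (subst (3) sum.swap) simp
    also have "\<dots> = 3 * quad z * herm z z"
      by (simp add: quad_def herm_def sum_product power2_eq_square)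
    finally show ?thesis by (simp only: herm_self)
  qed
  have DD: "?S (\<lambda>i j k. (cmod (D i j k))\<^sup>2) = 3 * ?n * (norm z)\<^sup>2"
    unfolding D_def norm_sq_sum by (rule kron_tensor_norm)
  have "(cmod (?A i j k - c * D i j k))\<^sup>2 =
     (cmod (?A i j k))\<^sup>2 - 2 * Re (cnj c * (?A i j k * cnj (D i j k))) + (cmod c)\<^sup>2 * (cmod (D i j k))\<^sup>2" for i j k
  proof -
    have "(cmod (x - c * d))\<^sup>2 = (cmod x)\<^sup>2 - 2 * Re (cnj c * (x * cnj d)) + (cmod c)\<^sup>2 * (cmod d)\<^sup>2" for x d
      by (simp only: cmod_power2) (simp add: algebra_simps power2_eq_square)
    then show ?thesis .
  qed
  then have "?S (\<lambda>i j k. (cmod (?A i j k - c * D i j k))\<^sup>2) =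
      ?S (\<lambda>i j k. (cmod (?A i j k))\<^sup>2) - 2 * Re (cnj c * ?S (\<lambda>i j k. ?A i j k * cnj (D i j k)))
      + (cmod c)\<^sup>2 * ?S (\<lambda>i j k. (cmod (D i j k))\<^sup>2)"
    by (simp only: sum.distrib sum_subtractf sum_distrib_left Re_sum)
  also have "\<dots> = ((norm z)\<^sup>2) ^ 3 - 2 * Re (cnj c * (3 * quad z * of_real ((norm z)\<^sup>2))) + (cmod c)\<^sup>2 * (3 * ?n * (norm z)\<^sup>2)"
    by (simp only: AA AD DD)
  also have "cnj c * (3 * quad z * of_real ((norm z)\<^sup>2)) = of_real (3 / ?n * (cmod (quad z))\<^sup>2 * (norm z)\<^sup>2)"
  proof -
    have "cnj c * quad z = of_real ((cmod (quad z))\<^sup>2 / ?n)"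
      unfolding c_def by (simp only: complex_norm_square of_real_divide) simp
    moreover have "cnj c * (3 * quad z * of_real ((norm z)\<^sup>2)) = 3 * (cnj c * quad z) * of_real ((norm z)\<^sup>2)"
      by (simp add: mult_ac)
    ultimately have "cnj c * (3 * quad z * of_real ((norm z)\<^sup>2)) = 3 * of_real ((cmod (quad z))\<^sup>2 / ?n) * of_real ((norm z)\<^sup>2)"
      by (simp only:)
    then show ?thesis by simp
  qed
  also have "(cmod c)\<^sup>2 * (3 * ?n * (norm z)\<^sup>2) = 3 / ?n * (cmod (quad z))\<^sup>2 * (norm z)\<^sup>2"
  proof -
    have c: "cmod c = cmod (quad z) / ?n" unfolding c_def norm_divide norm_of_real using n by simp
    have "(a / m)\<^sup>2 * (3 * m * r) = 3 / m * a\<^sup>2 * r" if "m > 0" for a m r :: real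
      using that by (simp add: power2_eq_square)
    from this[OF n] show ?thesis unfolding c .
  qed
  finally show ?thesis unfolding c' by (simp add: algebra_simps)
qed

section \<open>Construction of the sphere map\<close>

text \<open>
  A common divisor \<open>h\<close> of \<open>g\<close> and all \<open>\<kappa> q z\<^sub>i\<close> divides \<open>z\<^sub>i = g z\<^sub>i - \<sigma> q z\<^sub>i\<close>. Restricted to a line
  through the origin and a point with \<open>z\<^sub>i \<noteq> 0\<close>, it divides a nonzero multiple of the parameter
  \<open>t\<close>. Since \<open>h\<close> does not vanish at the origin, it is constant on every such line.
\<close>

lemma common_divisor_constant:
  fixes h g :: "'n::finite cpoly" and \<sigma> \<kappa> :: complex
  assumes g: "\<And>z. eval_cpoly g z = 1 + \<sigma> * quad z" and "h dvd g" "\<kappa> \<noteq> 0"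
    and div: "\<And>i. \<exists>f. h dvd f \<and> (\<forall>z. eval_cpoly f z = \<kappa> * quad z * z $ i)"
  shows "total_degree h = 0"
proof -
  obtain u where u: "g = h * u" using \<open>h dvd g\<close> by blast
  have hu: "eval_cpoly h z * eval_cpoly u z = 1 + \<sigma> * quad z" for z
    using g[of z] by (simp add: u)
  have h0: "eval_cpoly h 0 \<noteq> 0" using hu[of 0] by (auto simp: quad_def)
  have "eval_cpoly h z = eval_cpoly h 0" for z
  proof (cases "z = 0")
    case False
    then obtain i where i: "z $ i \<noteq> 0" by (metis vec_eq_iff zero_index)
    obtain v where v: "\<And>z. eval_cpoly h z * eval_cpoly v z = \<kappa> * quad z * z $ i"
    proof -
      obtain f where f: "h dvd f" "\<And>z. eval_cpoly f z = \<kappa> * quad z * z $ i"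
        using div[of i] by blast
      from f(1) obtain v where "f = h * v" by (rule dvdE)
      with f(2) show ?thesis by (intro that[of v]) auto
    qed
    define w where "w = u * Var i - Cst (\<sigma> / \<kappa>) * v"
    have w: "eval_cpoly h y * eval_cpoly w y = y $ i" for y
    proof -
      have "eval_cpoly h y * eval_cpoly w y = eval_cpoly h y * eval_cpoly u y * y $ i
          - \<sigma> / \<kappa> * (eval_cpoly h y * eval_cpoly v y)"
        by (simp add: w_def algebra_simps)
      then show ?thesis using \<open>\<kappa> \<noteq> 0\<close> by (simp add: hu v algebra_simps)
    qed
    obtain r s :: "complex poly" where r: "\<And>t. poly r t = eval_cpoly h (t *s z)"
      and s: "\<And>t. poly s t = eval_cpoly w (t *s z)"
      using eval_cpoly_along_line[OF order.refl] by metis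
    have rs: "r * s = [:0, z $ i:]"
    proof -
      have "poly (r * s) = poly [:0, z $ i:]" by (rule ext) (simp add: r s w)
      then show ?thesis by (simp only: poly_eq_poly_eq_iff)
    qed
    then have nz: "r \<noteq> 0" "s \<noteq> 0" using i by auto
    have "degree r + degree s = 1"
      using degree_mult_eq[OF nz] i by (simp add: rs)
    moreover have "degree s \<noteq> 0"
    proof
      assume "degree s = 0"
      then obtain d where d: "s = [:d:]" by (auto elim: degree_eq_zeroE)
      have "poly (r * s) 0 = 0" by (simp add: rs)
      then have "eval_cpoly h 0 * d = 0" by (auto simp: r d)
      with h0 nz(2) d show False by simp
    qed
    ultimately have "degree r = 0" by simp
    then obtain d where "r = [:d:]" by (auto elim: degree_eq_zeroE)
    with r[of 0] r[of 1] show ?thesis by simp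
  qed simp
  then have "h = Cst (eval_cpoly h 0)" by (intro eval_cpoly_inject) simp
  then show ?thesis by (metis total_degree_Cst)
qed

definition quadP :: "'n::finite cpoly" where "quadP = (\<Sum>j\<in>UNIV. (Var j)\<^sup>2)"

lemma eval_quadP [simp]: "eval_cpoly quadP z = quad z"
  by (simp add: quadP_def quad_def)

lemma total_degree_quadP: "total_degree quadP \<le> 2"
  unfolding quadP_def power2_eq_square
  by (intro total_degree_sum_le order.trans[OF total_degree_mult_le[OF total_degree_Var_le total_degree_Var_le]])
     simp

lemma total_degree_Cst_mult_le: "total_degree p \<le> d \<Longrightarrow> total_degree (Cst c * p) \<le> d"
  using total_degree_mult_le[of "Cst c" 0 p d] by simp

lemma total_degree_quadP_Var: "total_degree (quadP * Var i) \<le> 3"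
  using total_degree_mult_le[OF total_degree_quadP total_degree_Var_le] by simp

text \<open>
  The second family ensures that the map is reduced and of degree exactly three: its coefficient \<open>\<kappa>\<close> is
  nonzero for the parameters chosen below, also when \<open>\<sigma> = 0\<close>.
\<close>

fun component :: "real \<Rightarrow> real \<Rightarrow> real \<Rightarrow> 'n::finite + 'n + 'n \<times> 'n \<times> 'n \<Rightarrow> 'n cpoly" where
  "component \<sigma> \<beta> \<kappa> (Inl i) = Cst (of_real (sqrt \<beta>)) * Var i + Cst (of_real (\<sigma> / sqrt \<beta>)) * (quadP * Var i)"
| "component \<sigma> \<beta> \<kappa> (Inr (Inl i)) = Cst (of_real \<kappa>) * (quadP * Var i)"
| "component \<sigma> \<beta> \<kappa> (Inr (Inr (i, j, k))) = Cst (of_real (sqrt (1 - \<beta>))) *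
     (Var i * Var j * Var k + Cst (- 1 / (of_nat CARD('n) + 2)) *
       (quadP * (Cst (kron i j) * Var k + Cst (kron i k) * Var j + Cst (kron j k) * Var i)))"

lemma total_degree_component: "total_degree (component \<sigma> \<beta> \<kappa> x) \<le> 3"
proof (induction \<sigma> \<beta> \<kappa> x rule: component.induct)
  case (1 \<sigma> \<beta> \<kappa> i)
  have "total_degree (Var i) \<le> 3" using total_degree_Var_le[of i] by simp
  then show ?case
    by (auto intro!: total_degree_add_le total_degree_Cst_mult_le total_degree_quadP_Var)
next
  case (3 \<sigma> \<beta> \<kappa> i j k)
  have "total_degree (Var i * Var j * Var k) \<le> 1 + 1 + 1"
    by (intro total_degree_mult_le total_degree_Var_le)
  moreover have "total_degree (quadP * (Cst (kron i j) * Var k + Cst (kron i k) * Var j + Cst (kron j k) * Var i)) \<le> 2 + 1"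
    by (intro total_degree_mult_le total_degree_quadP total_degree_add_le total_degree_Cst_mult_le total_degree_Var_le)
  ultimately show ?case
    by (auto intro!: total_degree_add_le total_degree_Cst_mult_le)
qed (auto intro!: total_degree_Cst_mult_le total_degree_quadP_Var)

text \<open>
  On the unit sphere the first family has norm \<open>\<beta> + 2 \<sigma> Re q + (\<sigma>\<^sup>2 / \<beta>) \<bar>q\<bar>\<^sup>2\<close>, which already has the
  correct cross term; the value of \<open>\<kappa>\<^sup>2\<close> is the one that makes the coefficient of \<open>\<bar>q\<bar>\<^sup>2\<close> equal to \<open>\<sigma>\<^sup>2\<close>.
\<close>

lemma component_norm:
  fixes z :: "complex ^ 'n::finite"
  defines "l \<equiv> (real CARD('n) + 2) / 3"
  assumes z: "norm z = 1" and \<beta>: "0 < \<beta>" "\<beta> < 1" and \<kappa>: "\<kappa>\<^sup>2 = (1 - \<beta>) / \<beta> * (\<beta> / l - \<sigma>\<^sup>2)"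
  shows "(\<Sum>x\<in>UNIV. (cmod (eval_cpoly (component \<sigma> \<beta> \<kappa> x) z))\<^sup>2) = (cmod (1 + of_real \<sigma> * quad z))\<^sup>2"
proof -
  let ?f = "\<lambda>x. (cmod (eval_cpoly (component \<sigma> \<beta> \<kappa> x) z))\<^sup>2"
  let ?q = "(cmod (quad z))\<^sup>2"
  have z1: "(\<Sum>j\<in>UNIV. (cmod (z $ j))\<^sup>2) = 1" using z by (simp flip: norm_sq_sum)
  have "(\<Sum>x\<in>UNIV. ?f x) = (\<Sum>i\<in>UNIV. ?f (Inl i)) + ((\<Sum>i\<in>UNIV. ?f (Inr (Inl i))) +
      (\<Sum>x\<in>UNIV. ?f (Inr (Inr x))))"
    by (simp only: UNIV_Plus_UNIV[symmetric] sum.Plus finite_UNIV finite_Plus o_def finite)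
  moreover have "(\<Sum>i\<in>UNIV. ?f (Inl i)) = \<beta> + 2 * \<sigma> * Re (quad z) + \<sigma>\<^sup>2 / \<beta> * ?q"
  proof -
    have "?f (Inl i) = (cmod (of_real (sqrt \<beta>) + of_real (\<sigma> / sqrt \<beta>) * quad z))\<^sup>2 * (cmod (z $ i))\<^sup>2" for i
      by (simp add: algebra_simps flip: norm_mult power_mult_distrib)
    then have "(\<Sum>i\<in>UNIV. ?f (Inl i)) = (cmod (of_real (sqrt \<beta>) + of_real (\<sigma> / sqrt \<beta>) * quad z))\<^sup>2"
      by (simp add: z1 flip: sum_distrib_left)
    also have "\<dots> = \<beta> + 2 * \<sigma> * Re (quad z) + \<sigma>\<^sup>2 / \<beta> * ?q"
      using \<beta> by (simp only: cmod_power2) (simp add: field_simps power2_eq_square real_sqrt_mult_self)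
    finally show ?thesis .
  qed
  moreover have "(\<Sum>i\<in>UNIV. ?f (Inr (Inl i))) = \<kappa>\<^sup>2 * ?q"
    by (simp add: norm_mult power_mult_distrib z1 flip: sum_distrib_left)
  moreover have "(\<Sum>x\<in>UNIV. ?f (Inr (Inr x))) = (1 - \<beta>) * (1 - ?q / l)"
  proof -
    have "?f (Inr (Inr (i, j, k))) = (1 - \<beta>) * (cmod (z $ i * z $ j * z $ k -
        quad z / (of_nat CARD('n) + 2) * (kron i j * z $ k + kron i k * z $ j + kron j k * z $ i)))\<^sup>2" for i j k
    proof -
      have "eval_cpoly (component \<sigma> \<beta> \<kappa> (Inr (Inr (i, j, k)))) z = of_real (sqrt (1 - \<beta>)) *
        (z $ i * z $ j * z $ k -
        quad z / (of_nat CARD('n) + 2) * (kron i j * z $ k + kron i k * z $ j + kron j k * z $ i))"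
        by simp
      then show ?thesis using \<beta> by (simp only: norm_mult power_mult_distrib norm_of_real) simp
    qed
    then have "(\<Sum>x\<in>UNIV. ?f (Inr (Inr x))) = (1 - \<beta>) * (1 - 3 / (real CARD('n) + 2) * ?q)"
      using harmonic_cubes_norm[of z] z
      by (simp only: UNIV_Times_UNIV[symmetric] sum.cartesian_product' sum_distrib_left[symmetric]) simp
    then show ?thesis by (simp add: l_def)
  qed
  moreover have "(cmod (1 + of_real \<sigma> * quad z))\<^sup>2 = 1 + 2 * \<sigma> * Re (quad z) + \<sigma>\<^sup>2 * ?q"
    by (simp only: cmod_power2) (simp add: algebra_simps power2_eq_square)
  moreover have "\<sigma>\<^sup>2 / \<beta> * ?q + \<kappa>\<^sup>2 * ?q + (1 - \<beta>) * (1 - ?q / l) = 1 - \<beta> + \<sigma>\<^sup>2 * ?q"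
  proof -
    have "\<kappa>\<^sup>2 = (1 - \<beta>) / l - (1 - \<beta>) * \<sigma>\<^sup>2 / \<beta>" using \<beta> by (simp add: \<kappa> field_simps)
    then show ?thesis using \<beta> by (simp only:) (simp add: field_simps)
  qed
  ultimately show ?thesis by simp
qed

lemma sphere_map_if_bound:
  fixes g :: "'n::finite cpoly" and \<sigma> :: real
  assumes \<sigma>: "\<sigma> \<ge> 0" "\<sigma>\<^sup>2 * ((real CARD('n) + 2) / 3) < 1"
    and g: "g = 1 + Cst (of_real \<sigma>) * (\<Sum>j\<in>UNIV. (Var j)\<^sup>2)"
  shows "\<exists>N p. sphere_map N p g \<and> reduced_map N p g \<and> pointed_map N p g \<and> rational_degree N p g = 3"
proof -
  define l where "l = (real CARD('n) + 2) / 3"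
  have l: "l \<ge> 1" "\<sigma>\<^sup>2 * l < 1"
    using \<sigma> by (simp_all add: l_def Suc_le_eq)
  \<comment> \<open>Any value strictly between \<open>\<sigma>\<^sup>2 l\<close> and \<open>1\<close> would do; the bounds make \<open>\<kappa>\<^sup>2\<close> positive.\<close>
  define \<beta> where "\<beta> = (1 + \<sigma>\<^sup>2 * l) / 2"
  have \<beta>: "0 < \<beta>" "\<beta> < 1" "\<sigma>\<^sup>2 * l < \<beta>" using l by (auto simp: \<beta>_def add_pos_nonneg mult.commute)
  define \<kappa> where "\<kappa> = sqrt ((1 - \<beta>) / \<beta> * (\<beta> / l - \<sigma>\<^sup>2))"
  have pos: "(1 - \<beta>) / \<beta> * (\<beta> / l - \<sigma>\<^sup>2) > 0"
    using \<beta> l by (intro mult_pos_pos) (auto simp: field_simps)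
  then have \<kappa>: "\<kappa> \<noteq> 0" "\<kappa>\<^sup>2 = (1 - \<beta>) / \<beta> * (\<beta> / l - \<sigma>\<^sup>2)" by (auto simp: \<kappa>_def)
  define F :: "'n + 'n + 'n \<times> 'n \<times> 'n \<Rightarrow> 'n cpoly" where "F = component \<sigma> \<beta> \<kappa>"
  have geq: "g = 1 + Cst (of_real \<sigma>) * quadP" by (simp add: g quadP_def)
  have ge: "eval_cpoly g z = 1 + of_real \<sigma> * quad z" for z by (simp add: geq)
  obtain e where e: "bij_betw e {..<CARD('n + 'n + 'n \<times> 'n \<times> 'n)} (UNIV :: ('n + 'n + 'n \<times> 'n \<times> 'n) set)"
    using ex_bij_betw_nat_finite[OF finite[of "UNIV :: ('n + 'n + 'n \<times> 'n \<times> 'n) set"]]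
    unfolding atLeast0LessThan by (rule exE)
  define N where "N = CARD('n + 'n + 'n \<times> 'n \<times> 'n)"
  define p where "p = (\<lambda>i. F (e i))"
  have img: "\<exists>i<N. p i = F x" for x
  proof -
    have "x \<in> e ` {..<N}" unfolding N_def bij_betw_imp_surj_on[OF e] by (rule UNIV_I)
    then show ?thesis by (auto simp: p_def)
  qed
  have nz: "eval_cpoly g z \<noteq> 0" if "z \<in> ball 0 1" for z
  proof
    assume "eval_cpoly g z = 0"
    then have "of_real \<sigma> * quad z = -1" by (simp add: ge eq_neg_iff_add_eq_0 add.commute)
    then have "cmod (of_real \<sigma> * quad z) = 1" by simp
    then have "\<sigma> * cmod (quad z) = 1" using \<sigma>(1) by (simp add: norm_mult)
    moreover have "cmod (quad z) < 1"
    proof -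
      have "norm z < 1" using that by (simp add: dist_norm)
      then have "(norm z)\<^sup>2 < 1" by (simp add: power_less_one_iff abs_square_less_1)
      then show ?thesis using norm_quad_le[of z] by linarith
    qed
    moreover have "\<sigma> \<le> 1"
    proof (rule ccontr)
      assume "\<not> \<sigma> \<le> 1"
      then have "1 * 1 \<le> \<sigma>\<^sup>2 * l" using l by (intro mult_mono) (auto simp: one_le_power)
      with l show False by simp
    qed
    ultimately show False using \<sigma>(1) by (smt (verit) mult_left_le_one_le norm_ge_zero)
  qed
  have "sphere_map N p g"
    unfolding sphere_map_def
  proof (intro conjI ballI)
    show "holomorphic_quotient_on_ball N p g" by (rule holomorphic_quotientI[OF nz])
    fix z :: "complex ^ 'n" assume "z \<in> sphere 0 1"
    then have z: "norm z = 1" by (simp add: dist_norm)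
    have "(\<Sum>i<N. (cmod (eval_cpoly (p i) z))\<^sup>2) = (\<Sum>x\<in>UNIV. (cmod (eval_cpoly (F x) z))\<^sup>2)"
      unfolding p_def N_def by (rule sum.reindex_bij_betw[OF e])
    also have "\<dots> = (cmod (eval_cpoly g z))\<^sup>2"
      unfolding F_def ge by (rule component_norm[OF z \<beta>(1,2) \<kappa>(2)[unfolded l_def]])
    finally show "(\<Sum>i<N. (cmod (eval_cpoly (p i) z))\<^sup>2) = (cmod (eval_cpoly g z))\<^sup>2" .
  qed
  moreover have "reduced_map N p g"
    unfolding reduced_map_def
  proof
    assume "\<exists>h. 0 < total_degree h \<and> h dvd g \<and> (\<forall>i<N. h dvd p i)"
    then obtain h where h: "0 < total_degree h" "h dvd g" "\<And>i. i < N \<Longrightarrow> h dvd p i" by blast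
    have "total_degree h = 0"
    proof (rule common_divisor_constant[OF ge h(2)])
      show "complex_of_real \<kappa> \<noteq> 0" using \<kappa> by simp
      show "\<exists>f. h dvd f \<and> (\<forall>z. eval_cpoly f z = of_real \<kappa> * quad z * z $ i)" for i
      proof -
        obtain m where "m < N" "p m = F (Inr (Inl i))" using img by blast
        then have "h dvd F (Inr (Inl i))" using h(3)[of m] by simp
        then show ?thesis by (intro exI[of _ "F (Inr (Inl i))"]) (simp add: F_def)
      qed
    qed
    with h(1) show False by simp
  qed
  moreover have "pointed_map N p g"
  proof -
    have "eval_cpoly (F x) 0 = 0" for x
      unfolding F_def by (induction \<sigma> \<beta> \<kappa> x rule: component.induct) (simp_all add: quad_def)
    then show ?thesis by (simp add: pointed_map_def ge p_def quad_def)
  qed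
  moreover have "rational_degree N p g = 3"
  proof -
    have le: "total_degree (p i) \<le> 3" for i by (simp add: p_def F_def total_degree_component)
    have "total_degree g \<le> 2"
      unfolding geq by (auto intro!: total_degree_add_le total_degree_Cst_mult_le total_degree_quadP)
    moreover obtain i where i: "i < N" "p i = F (Inr (Inl undefined))" using img by blast
    have "\<not> total_degree (p i) \<le> 2"
    proof
      assume "total_degree (p i) \<le> 2"
      then obtain r :: "complex poly" where r: "degree r \<le> 2"
        "\<And>t. poly r t = eval_cpoly (p i) (t *s axis undefined 1)"
        by (rule eval_cpoly_along_line) blast
      have "poly r = poly (Polynomial.monom (of_real \<kappa>) 3)"
      proof
        fix t
        have "quad (axis undefined 1 :: complex ^ 'n) = 1"
          by (simp add: quad_def axis_def if_distrib[of "\<lambda>x. x\<^sup>2"] cong: if_cong)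
        then show "poly r t = poly (Polynomial.monom (of_real \<kappa>) 3) t"
          by (simp add: r(2) i(2) F_def quad_scale poly_monom power2_eq_square power3_eq_cube)
      qed
      then have "r = Polynomial.monom (of_real \<kappa>) 3" by (simp only: poly_eq_poly_eq_iff)
      with r(1) \<kappa>(1) show False by (simp add: degree_monom_eq)
    qed
    with le[of i] have "total_degree (p i) = 3" by simp
    ultimately show ?thesis unfolding rational_degree_def
      using le i(1) by (intro Max_eqI) (auto intro: order.trans)
  qed
  ultimately show ?thesis by blast
qed

section \<open>Characterisation of the admissible denominators\<close>

theorem theorem6p3:
  fixes \<sigma> :: real and g :: "'n::finite cpoly"
  assumes "CARD('n) \<ge> 2" and "\<sigma> \<ge> 0"
    and "g = 1 + Cst (complex_of_real \<sigma>) * (\<Sum>j\<in>UNIV. (Var j)\<^sup>2)"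
  shows "(\<exists>N (p :: nat \<Rightarrow> 'n cpoly).
            sphere_map N p g \<and> reduced_map N p g \<and> pointed_map N p g \<and> rational_degree N p g = 3)
         \<longleftrightarrow> \<sigma> < sqrt (3 / (real CARD('n) + 2))"
proof -
  have ge: "eval_cpoly g z = 1 + of_real \<sigma> * quad z" for z
    by (simp add: assms(3) quad_def)
  have bound: "\<sigma> < sqrt (3 / (real CARD('n) + 2)) \<longleftrightarrow> \<sigma>\<^sup>2 * ((real CARD('n) + 2) / 3) < 1"
  proof -
    have "\<sigma> < sqrt (3 / (real CARD('n) + 2)) \<longleftrightarrow> sqrt (\<sigma>\<^sup>2) < sqrt (3 / (real CARD('n) + 2))"
      using assms(2) by simp
    also have "\<dots> \<longleftrightarrow> \<sigma>\<^sup>2 < 3 / (real CARD('n) + 2)" by (rule real_sqrt_less_iff)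
    also have "\<dots> \<longleftrightarrow> \<sigma>\<^sup>2 * ((real CARD('n) + 2) / 3) < 1" by (simp add: field_simps)
    finally show ?thesis .
  qed
  show ?thesis
  proof
    assume "\<sigma> < sqrt (3 / (real CARD('n) + 2))"
    then show "\<exists>N (p :: nat \<Rightarrow> 'n cpoly).
            sphere_map N p g \<and> reduced_map N p g \<and> pointed_map N p g \<and> rational_degree N p g = 3"
      unfolding bound using assms by (intro sphere_map_if_bound)
  next
    assume "\<exists>N (p :: nat \<Rightarrow> 'n cpoly).
            sphere_map N p g \<and> reduced_map N p g \<and> pointed_map N p g \<and> rational_degree N p g = 3"
    then obtain N and p :: "nat \<Rightarrow> 'n cpoly" where p: "sphere_map N p g" "reduced_map N p g"
      "pointed_map N p g" "rational_degree N p g = 3" by blast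
    show "\<sigma> < sqrt (3 / (real CARD('n) + 2))"
    proof (cases "\<sigma> = 0")
      case False
      with assms(2) have \<sigma>: "\<sigma> > 0" by simp
      \<comment> \<open>A positive degree makes \<open>g\<close> itself an admissible common factor.\<close>
      have "total_degree g > 0"
      proof (rule ccontr)
        assume "\<not> 0 < total_degree g"
        then have "eval_cpoly g (axis undefined 1) = eval_cpoly g 0"
          by (intro total_degree_zeroD) simp
        moreover have "quad (axis undefined 1 :: complex ^ 'n) = 1"
          by (simp add: quad_def axis_def if_distrib[of "\<lambda>x. x\<^sup>2"] cong: if_cong)
        ultimately show False using \<sigma> by (simp add: ge) (simp add: quad_def)
      qed
      then have "\<not> (\<forall>s<N. g dvd p s)" using p(2) dvd_refl[of g] unfolding reduced_map_def by blast
      moreover have "total_degree (p s) \<le> 3" if "s < N" for s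
        using p(4) that unfolding rational_degree_def by (metis Max_ge finite_imageI finite_insert
            finite_lessThan imageI insertCI lessThan_iff)
      moreover have "eval_cpoly (p s) 0 = 0" if "s < N" for s
        using p(3) that by (simp add: pointed_map_def)
      moreover have "(\<Sum>s<N. (cmod (eval_cpoly (p s) z))\<^sup>2) = (cmod (eval_cpoly g z))\<^sup>2"
        if "norm z = 1" for z
        using p(1) that by (simp add: sphere_map_def)
      ultimately show ?thesis
        unfolding bound by (intro sphere_map_imp_bound[OF assms(1) \<sigma> ge])
    qed simp
  qed
qed

end
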